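(* Let $\alpha, \gamma \in \mathbb{R}$, and assume that $\alpha$ is irrational and not Liouville. Let $\psi: \mathbb{N} \to \mathbb{R}_{\ge 0}$ be a decreasing function such that \[ \sum_{n=1}^\infty \psi(n) \log n = \infty. \] Then for almost all $\beta \in \mathbb{R}$ (with respect to Lebesgue measure) there exist infinitely many $n \in \mathbb{N}$ such that \[ \| n \alpha - \gamma \| \cdot \| n \beta \| < \psi(n). \]
   Context: For $x \in \mathbb{R}$, $\|x\|$ denotes the distance from $x$ to the nearest integer. An irrational real number $\alpha$ is Liouville if $\liminf_{n \to \infty} n^w \| n \alpha \| = 0$ for all $w > 0$. "Decreasing" means $\psi(n) \ge \psi(n+1)$ for all $n$. *)

theory Defs
  imports "HOL-Analysis.Analysis"
begin

definition dist_int :: "real \<Rightarrow> real" where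
  "dist_int x = infdist x \<int>"

lemma dist_int_altdef: "dist_int x = \<bar>x - of_int (round x)\<bar>"
  unfolding dist_int_def
proof (rule antisym)
  show "infdist x \<int> \<le> \<bar>x - of_int (round x)\<bar>"
    using infdist_le[of "of_int (round x)" "\<int>" x] by (simp add: dist_real_def)
  show "\<bar>x - of_int (round x)\<bar> \<le> infdist x \<int>"
    unfolding infdist_def
    by (auto intro!: cINF_greatest elim!: Ints_cases simp: dist_real_def round_diff_minimal)
qed

(* The liminf is taken in the extended reals, where it always exists. *)
definition liouville :: "real \<Rightarrow> bool" where
  "liouville \<alpha> \<longleftrightarrow> \<alpha> \<notin> \<rat> \<and>
     (\<forall>w::real. w > 0 \<longrightarrow>
        liminf (\<lambda>n::nat. ereal (real n powr w * dist_int (real n * \<alpha>))) = 0)"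

end

theory Submission
  imports Defs "HOL-Number_Theory.Totient"
begin

text \<open>Put \<open>\<delta> n = \<psi> n / \<parallel>n\<alpha> - \<gamma>\<parallel>\<close> for those \<open>n\<close> with \<open>\<phi>(n) \<ge> n/2\<close>, and \<open>\<delta> n = 0\<close>
  otherwise. By the Duffin--Schaeffer argument it suffices that \<open>\<Sum>\<delta> n\<close> diverges: the sets of
  \<open>\<beta>\<close> within \<open>\<delta> n / n\<close> of a reduced fraction with denominator \<open>n\<close> are quasi-independent, so
  their limsup has positive measure, and a zero-one law makes it full.

  Since \<open>\<alpha>\<close> is not Liouville, the points \<open>n\<alpha>\<close> with \<open>n \<le> N\<close> are equidistributed at all scales
  down to a negative power of \<open>N\<close>, even along \<open>n\<close> divisible by a given small \<open>d\<close>. The former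
  gives the factor \<open>log N\<close> in the average of \<open>1 / \<parallel>n\<alpha> - \<gamma>\<parallel>\<close>, the latter shows that
  restricting to \<open>\<phi>(n) \<ge> n/2\<close> loses only a constant factor. Divergence of \<open>\<Sum>\<delta> n\<close> then follows
  from that of \<open>\<Sum>\<psi>(n) log n\<close> by Cauchy condensation.\<close>

section \<open>A zero-one law for periodic sets\<close>

text \<open>Reduced fractions cure the overlaps, but the measure drops by the factor \<phi>(n)/n;
  hence the restriction on n.

  Integers with large totient are sought in the progression n = Mk + 1 with M = 192!, which has no
  divisors between 2 and 192. Counting those divisible by a larger d leads to the multiple
  dM\<alpha> in place of \<alpha>, with the weaker Diophantine constant c/(dM)^w, and to a block
  shortened by the factor d. As d runs up to the order of 1/\<rho>, scale \<rho> requires a block of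
  length about \<rho>^-(2w+1). So the scales that can be reached stop at a fixed negative power of
  the block length, which still leaves a positive proportion of the dyadic scales and recovers the
  logarithm up to a constant.\<close>

lemma dist_int_le: "dist_int x \<le> \<bar>x - of_int m\<bar>"
  using round_diff_minimal[of x m] by (simp add: dist_int_altdef)

lemma dist_int_nonneg [simp]: "0 \<le> dist_int x"
  by (simp add: dist_int_altdef)

lemma dist_int_add_int [simp]: "dist_int (x + of_int m) = dist_int x"
proof (rule antisym)
  show "dist_int (x + of_int m) \<le> dist_int x"
    using dist_int_le[of "x + of_int m" "round x + m"] by (simp add: dist_int_altdef[of x])
  show "dist_int x \<le> dist_int (x + of_int m)"
    using dist_int_le[of x "round (x + of_int m) - m"]
    by (simp add: dist_int_altdef[of "x + of_int m"] algebra_simps)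
qed

lemma dist_int_add_le: "dist_int (x + y) \<le> dist_int x + dist_int y"
  using dist_int_le[of "x + y" "round x + round y"]
  by (simp add: dist_int_altdef[of x] dist_int_altdef[of y])

lemma dist_int_minus [simp]: "dist_int (- x) = dist_int x"
proof -
  have "dist_int (- x) \<le> dist_int x" for x
    using dist_int_le[of "- x" "- round x"] by (simp add: dist_int_altdef[of x])
  from this[of x] this[of "- x"] show ?thesis by simp
qed

lemma dist_int_of_nat_mult_le: "dist_int (real n * x) \<le> real n * dist_int x"
proof -
  have "dist_int (real n * x) \<le> \<bar>real n * x - of_int (int n * round x)\<bar>"
    by (rule dist_int_le)
  also have "\<dots> = real n * dist_int x"
    by (simp add: dist_int_altdef abs_mult flip: right_diff_distrib)
  finally show ?thesis .
qed

lemma dist_int_eq_abs: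
  assumes "\<bar>x\<bar> \<le> 1 / 2"
  shows "dist_int x = \<bar>x\<bar>"
proof (rule antisym)
  show "dist_int x \<le> \<bar>x\<bar>" using dist_int_le[of x 0] by simp
  show "\<bar>x\<bar> \<le> dist_int x"
  proof (cases "round x = 0")
    case False
    then have "\<bar>real_of_int (round x)\<bar> \<ge> 1" by linarith
    with assms show ?thesis unfolding dist_int_altdef by linarith
  qed (simp add: dist_int_altdef)
qed

lemma borel_measurable_dist_int [measurable]: "dist_int \<in> borel_measurable borel"
  unfolding dist_int_def by (intro borel_measurable_continuous_onI continuous_intros)

lemma dist_int_pos_of_irrational:
  assumes "\<alpha> \<notin> \<rat>" "q \<ge> 1"
  shows "dist_int (real q * \<alpha>) > 0"
proof (rule ccontr)
  assume "\<not> ?thesis"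
  then have "real q * \<alpha> = of_int (round (real q * \<alpha>))"
    using dist_int_nonneg[of "real q * \<alpha>"] by (simp add: dist_int_altdef)
  then have "\<alpha> = of_int (round (real q * \<alpha>)) / real q"
    using assms(2) by (simp add: field_simps)
  then show False using assms(1) by (metis Rats_divide Rats_of_int Rats_of_nat)
qed

section \<open>Lebesgue measure under affine maps and on half-open intervals\<close>

lemma emeasure_lborel_affine_vimage:
  fixes A :: "real set"
  assumes "c > 0" "A \<in> sets borel"
  shows "emeasure lborel A = ennreal c * emeasure lborel {x. t + c * x \<in> A}"
proof -
  have [measurable]: "A \<in> sets borel" by fact
  have "emeasure lborel A
      = emeasure (density (distr lborel borel (\<lambda>x. t + c * x)) (\<lambda>_. ennreal \<bar>c\<bar>)) A"
    using lborel_real_affine[of c t] assms(1) by simp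
  also have "\<dots> = ennreal c * emeasure (distr lborel borel (\<lambda>x. t + c * x)) A"
    using assms by (subst emeasure_density) (auto simp: nn_integral_cmult_indicator)
  also have "\<dots> = ennreal c * emeasure lborel {x. t + c * x \<in> A}"
    by (subst emeasure_distr) (auto simp: vimage_def)
  finally show ?thesis .
qed

lemma measure_lborel_affine_vimage:
  fixes A :: "real set"
  assumes "c > 0" "A \<in> sets borel"
  shows "measure lborel {x. t + c * x \<in> A} = measure lborel A / c"
  using emeasure_lborel_affine_vimage[OF assms, of t] assms(1)
  by (simp add: measure_def enn2real_mult)

lemma fmeasurable_Int_Ico [simp, intro]:
  fixes F :: "real set"
  assumes [measurable]: "F \<in> sets borel"
  shows "F \<inter> {a..<b} \<in> fmeasurable lborel"
proof (rule fmeasurableI2)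
  show "{a..b} \<in> fmeasurable lborel" using fmeasurable_cbox[of a b] by simp
qed (use assms in auto)

lemma measure_Int_Ico_sum:
  fixes F :: "real set"
  assumes F[measurable]: "F \<in> sets borel" and "l > 0"
    and each: "\<And>k. a \<le> k \<Longrightarrow> k < b \<Longrightarrow>
      measure lborel (F \<inter> {real_of_int k / l ..< (real_of_int k + 1) / l}) = v"
    and "a \<le> b"
  shows "measure lborel (F \<inter> {real_of_int a / l ..< real_of_int b / l}) = real_of_int (b - a) * v"
  using \<open>a \<le> b\<close> each
proof (induction b rule: int_ge_induct)
  case base
  then show ?case by simp
next
  case (step b)
  have split: "F \<inter> {real_of_int a / l ..< real_of_int (b + 1) / l}
     = (F \<inter> {real_of_int a / l ..< real_of_int b / l}) \<union>
       (F \<inter> {real_of_int b / l ..< (real_of_int b + 1) / l})"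
  proof -
    have "real_of_int a / l \<le> real_of_int b / l" "real_of_int b / l \<le> (real_of_int b + 1) / l"
      using step.hyps \<open>l > 0\<close> by (simp_all add: divide_right_mono)
    then have "{real_of_int a / l ..< real_of_int (b + 1) / l} = {real_of_int a / l ..< real_of_int b / l} \<union>
       {real_of_int b / l ..< (real_of_int b + 1) / l}"
      by (simp add: ivl_disj_un_two(3))
    then show ?thesis by blast
  qed
  have "measure lborel (F \<inter> {real_of_int a / l ..< real_of_int (b + 1) / l})
     = measure lborel (F \<inter> {real_of_int a / l ..< real_of_int b / l}) +
       measure lborel (F \<inter> {real_of_int b / l ..< (real_of_int b + 1) / l})"
    unfolding split
    by (rule measure_Union) (use F in \<open>auto intro!: fmeasurableD2 fmeasurable_Int_Ico\<close>)
  also have "\<dots> = real_of_int (b + 1 - a) * v"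
    using step.IH step.prems[of b] step.prems step.hyps by (simp add: algebra_simps)
  finally show ?case .
qed

lemma periodic_of_int:
  assumes "\<And>x::real. x + 1 \<in> F \<longleftrightarrow> x \<in> F"
  shows "x + of_int k \<in> F \<longleftrightarrow> x \<in> F"
proof (induction k rule: int_induct[of _ 0])
  case (step1 i)
  then show ?case using assms[of "x + of_int i"] by (simp add: add.assoc)
next
  case (step2 i)
  then show ?case using assms[of "x + of_int i - 1"] by (simp add: algebra_simps)
qed simp

lemma measure_lborel_translate_vimage:
  "A \<in> sets borel \<Longrightarrow> measure lborel {x. t + x \<in> A} = measure lborel (A :: real set)"
  using measure_lborel_affine_vimage[of 1 A t] by simp

text \<open>The preimage of \<open>F\<close> under multiplication by \<open>l\<close> contains \<open>F\<close> and has the same measure on a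
  period, so that the two agree up to a null set; and the preimage is equidistributed among the
  intervals \<open>[k/l, (k+1)/l)\<close>.\<close>

lemma measure_periodic_invariant_rational:
  fixes F :: "real set"
  assumes F[measurable]: "F \<in> sets borel" and per: "\<And>x. x + 1 \<in> F \<longleftrightarrow> x \<in> F"
    and inv: "\<And>x. x \<in> F \<Longrightarrow> real l * x \<in> F" and l: "l > 0"
  shows "measure lborel (F \<inter> {real_of_int k / l ..< (real_of_int k + 1) / l})
       = measure lborel (F \<inter> {0..<1}) / l"
proof -
  define p where "p = measure lborel (F \<inter> {0..<1})"
  define G where "G = {x. real l * x \<in> F}"
  have G[measurable]: "G \<in> sets borel" unfolding G_def by measurable
  have unit: "measure lborel (F \<inter> {real_of_int k ..< real_of_int k + 1}) = p" for k
  proof -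
    have "{x. real_of_int k + x \<in> F \<inter> {real_of_int k ..< real_of_int k + 1}} = F \<inter> {0..<1}"
      using periodic_of_int[OF per, of _ k] by (auto simp: add.commute)
    with measure_lborel_translate_vimage[of "F \<inter> {real_of_int k ..< real_of_int k + 1}" "real_of_int k"]
    show ?thesis by (simp add: p_def)
  qed
  have G_piece: "measure lborel (G \<inter> {real_of_int k / l ..< (real_of_int k + 1) / l}) = p / l" for k
  proof -
    have "{x. 0 + real l * x \<in> F \<inter> {real_of_int k ..< real_of_int k + 1}}
        = G \<inter> {real_of_int k / l ..< (real_of_int k + 1) / l}"
      using l by (auto simp: G_def field_simps)
    with measure_lborel_affine_vimage[of "real l" "F \<inter> {real_of_int k ..< real_of_int k + 1}" 0] l
    show ?thesis by (simp add: unit)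
  qed
  have "measure lborel (G \<inter> {real_of_int k ..< real_of_int k + 1}) = p" for k
    using measure_Int_Ico_sum[OF G, of "real l" "k * int l" "(k + 1) * int l" "p / l"] G_piece l
    by (simp add: mult_right_mono algebra_simps add_divide_distrib)
  then have "measure lborel (G \<inter> {real_of_int k ..< real_of_int k + 1} - F \<inter> {real_of_int k ..< real_of_int k + 1}) = 0" for k
    using inv unit[of k]
    by (subst measure_Diff) (auto simp: G_def intro!: fmeasurableD2 fmeasurable_Int_Ico)
  then have null: "G \<inter> {real_of_int k ..< real_of_int k + 1} - F \<inter> {real_of_int k ..< real_of_int k + 1}
      \<in> null_sets lborel" for k
    by (intro null_setsI) (auto simp: emeasure_eq_measure2 fmeasurable.Diff fmeasurable_Int_Ico)
  have "(\<Union>k. G \<inter> {real_of_int k ..< real_of_int k + 1} - F \<inter> {real_of_int k ..< real_of_int k + 1})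
      \<in> null_sets lborel"
    by (intro null_sets_UN' null) auto
  also have "(\<Union>k. G \<inter> {real_of_int k ..< real_of_int k + 1} - F \<inter> {real_of_int k ..< real_of_int k + 1}) = G - F"
  proof -
    have "x \<in> {real_of_int \<lfloor>x\<rfloor> ..< real_of_int \<lfloor>x\<rfloor> + 1}" for x :: real by simp
    then show ?thesis by blast
  qed
  finally have GF: "G - F \<in> null_sets lborel" .
  have "measure lborel (F \<inter> {real_of_int k / l ..< (real_of_int k + 1) / l})
     = measure lborel (F \<inter> {real_of_int k / l ..< (real_of_int k + 1) / l} \<union> (G - F))"
    by (rule measure_Un_null_set[symmetric]) (use GF in auto)
  also have "\<dots> = measure lborel (G \<inter> {real_of_int k / l ..< (real_of_int k + 1) / l} \<union> (G - F))"
    using inv by (intro arg_cong[of _ _ "measure lborel"]) (auto simp: G_def)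
  also have "\<dots> = measure lborel (G \<inter> {real_of_int k / l ..< (real_of_int k + 1) / l})"
    by (rule measure_Un_null_set) (use GF in auto)
  finally show ?thesis by (simp add: G_piece p_def)
qed

text \<open>F fills the same proportion p of every interval with rational endpoints, hence of every
  interval. So the measure with density 1/p on F agrees with Lebesgue measure on intervals and
  therefore everywhere; but it gives the complement of F measure 0.\<close>

lemma AE_periodic_invariant:
  fixes F :: "real set"
  assumes F[measurable]: "F \<in> sets borel" and per: "\<And>x. x + 1 \<in> F \<longleftrightarrow> x \<in> F"
    and inv: "\<And>l x. x \<in> F \<Longrightarrow> real l * x \<in> F"
    and pos: "measure lborel (F \<inter> {0..<1}) > 0"
  shows "AE x in lborel. x \<in> F"
proof -
  define p where "p = measure lborel (F \<inter> {0..<1})"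
  have "p > 0" using pos by (simp add: p_def)
  have rat: "measure lborel (F \<inter> {real_of_int a / real l ..< real_of_int b / real l})
      = real_of_int (b - a) * (p / l)" if "a \<le> b" "l > 0" for a b l
    by (rule measure_Int_Ico_sum) (use that F measure_periodic_invariant_rational[OF F per inv] in \<open>auto simp: p_def\<close>)
  have box: "measure lborel (F \<inter> {u<..<v}) = p * (v - u)" if uv: "u \<le> v" for u v
  proof -
    \<comment> \<open>Cells of length 1/l: [a/l, b/l) contains the interval and [(a+1)/l, (b-1)/l)
      lies inside it, and either length is off by at most 2/l.\<close>
    have bound: "\<bar>measure lborel (F \<inter> {u<..<v}) - p * (v - u)\<bar> \<le> 2 * p / real (Suc n)" for n
    proof -
      define l where "l = Suc n"
      define a where "a = \<lfloor>u * real l\<rfloor>"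
      define b where "b = \<lceil>v * real l\<rceil>"
      have l: "real l > 0" by (simp add: l_def)
      have a: "real_of_int a \<le> u * l" "u * l < real_of_int a + 1" by (simp_all add: a_def)
      have b: "v * l \<le> real_of_int b" "real_of_int b - 1 < v * l" unfolding b_def by linarith+
      have uvl: "u * l \<le> v * l" using uv by (simp add: mult_right_mono)
      have ab: "a \<le> b" using a b uvl by linarith
      have fm: "F \<inter> {u<..<v} \<in> fmeasurable lborel"
        by (rule fmeasurableI2[OF fmeasurable_Int_Ico[OF F, of u v]]) auto
      have "measure lborel (F \<inter> {u<..<v}) \<le> measure lborel (F \<inter> {real_of_int a / l ..< real_of_int b / l})"
      proof (rule measure_mono_fmeasurable)
        have "real_of_int a / l \<le> u" "v \<le> real_of_int b / l"
          using a b l by (simp_all add: field_simps)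
        then show "F \<inter> {u<..<v} \<subseteq> F \<inter> {real_of_int a / l ..< real_of_int b / l}"
          by auto
      qed (use F in auto)
      also have "\<dots> = real_of_int (b - a) * (p / l)" using rat[OF ab, of l] l by simp
      also have "\<dots> \<le> (v * l - u * l + 2) * (p / l)"
        using a b \<open>p > 0\<close> l by (intro mult_right_mono) auto
      also have "\<dots> = p * (v - u) + 2 * p / l" using l by (simp add: field_simps)
      finally have up: "measure lborel (F \<inter> {u<..<v}) \<le> p * (v - u) + 2 * p / l" .
      have "p * (v - u) - 2 * p / l = (v * l - u * l - 2) * (p / l)" using l by (simp add: field_simps)
      also have "\<dots> \<le> real_of_int (b - 1 - (a + 1)) * (p / l)"
        using a b \<open>p > 0\<close> l by (intro mult_right_mono) auto
      also have "\<dots> \<le> measure lborel (F \<inter> {u<..<v})"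
      proof (cases "a + 1 \<le> b - 1")
        case True
        have "real_of_int (b - 1 - (a + 1)) * (p / l)
          = measure lborel (F \<inter> {real_of_int (a + 1) / l ..< real_of_int (b - 1) / l})"
          using rat[OF True, of l] l by simp
        also have "\<dots> \<le> measure lborel (F \<inter> {u<..<v})"
        proof (rule measure_mono_fmeasurable[OF _ _ fm])
          have "u < real_of_int (a + 1) / l" "real_of_int (b - 1) / l < v"
            using a b l by (auto simp: field_simps)
          then show "F \<inter> {real_of_int (a + 1) / l ..< real_of_int (b - 1) / l} \<subseteq> F \<inter> {u<..<v}"
            by auto
        qed (use F in auto)
        finally show ?thesis .
      next
        case False
        then have "real_of_int (b - 1 - (a + 1)) * (p / l) \<le> 0"
          using \<open>p > 0\<close> l by (intro mult_nonpos_nonneg) auto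
        then show ?thesis using measure_nonneg[of lborel "F \<inter> {u<..<v}"] by linarith
      qed
      finally show ?thesis using up by (simp add: l_def abs_le_iff)
    qed
    have "(\<lambda>n. 2 * p / real (Suc n)) \<longlonglongrightarrow> 0"
      using LIMSEQ_Suc[OF lim_const_over_n[of "2 * p"]] by simp
    then have "\<bar>measure lborel (F \<inter> {u<..<v}) - p * (v - u)\<bar> \<le> 0"
      using bound by (intro LIMSEQ_le_const) auto
    then show ?thesis by simp
  qed
  define M where "M = density lborel (\<lambda>x. ennreal (1 / p) * indicator F x)"
  have M_eq: "emeasure M A = ennreal (1 / p) * emeasure lborel (F \<inter> A)" if [measurable]: "A \<in> sets borel" for A
  proof -
    have "emeasure M A = (\<integral>\<^sup>+x. ennreal (1 / p) * indicator (F \<inter> A) x \<partial>lborel)"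
      unfolding M_def by (subst emeasure_density) (auto intro!: nn_integral_cong simp: indicator_def)
    also have "\<dots> = ennreal (1 / p) * emeasure lborel (F \<inter> A)"
      by (subst nn_integral_cmult_indicator) auto
    finally show ?thesis .
  qed
  have "lborel = M"
  proof (rule lborel_eqI)
    fix u v :: real
    assume "\<And>b. b \<in> Basis \<Longrightarrow> u \<bullet> b \<le> v \<bullet> b"
    then have uv: "u \<le> v" by simp
    have "F \<inter> {u<..<v} \<in> fmeasurable lborel"
      by (rule fmeasurableI2[OF fmeasurable_Int_Ico[OF F, of u v]]) auto
    then have "emeasure lborel (F \<inter> {u<..<v}) = ennreal (p * (v - u))"
      using box[OF uv] by (simp add: emeasure_eq_measure2)
    then show "emeasure M (box u v) = (\<Prod>b\<in>Basis. (v - u) \<bullet> b)"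
      using uv \<open>p > 0\<close> by (simp add: M_eq flip: ennreal_mult)
  qed (simp add: M_def)
  then have "emeasure lborel (- F) = emeasure M (- F)" by simp
  also have "\<dots> = 0" by (subst M_eq) auto
  finally have "- F \<in> null_sets lborel" by (intro null_setsI) auto
  from AE_not_in[OF this] show ?thesis by simp
qed

section \<open>The Duffin--Schaeffer theorem\<close>

text \<open>Dividing the radius by n matches the condition \<open>dist_int (real n * x) < d\<close>.
  The numerators cover a single period; for n \<ge> 2 the numerator n does not occur, so the set
  stays inside the unit interval.\<close>

definition reduced_nbhd :: "nat \<Rightarrow> real \<Rightarrow> real set" where
  "reduced_nbhd n d = (\<Union>a\<in>totatives n. {(real a - d) / n <..< (real a + d) / n})"

lemma reduced_nbhd_borel [measurable]: "reduced_nbhd n d \<in> sets borel"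
  unfolding reduced_nbhd_def by (intro sets.finite_UN) auto

lemma dist_int_reduced_nbhd:
  assumes "x \<in> reduced_nbhd n d"
  shows "dist_int (real n * x) < d"
proof -
  obtain a where a: "a \<in> totatives n" and x: "(real a - d) / n < x" "x < (real a + d) / n"
    using assms by (auto simp: reduced_nbhd_def)
  have n: "n > 0" using a by (cases n) auto
  have "\<bar>real n * x - of_int (int a)\<bar> < d"
    using x n by (auto simp: field_simps abs_less_iff)
  with dist_int_le[of "real n * x" "int a"] show ?thesis by linarith
qed

lemma reduced_nbhd_subset:
  assumes "n \<ge> 2" "d \<le> 1"
  shows "reduced_nbhd n d \<subseteq> {0..<1}"
proof
  fix x assume "x \<in> reduced_nbhd n d"
  then obtain a where a: "a \<in> totatives n" and x: "(real a - d) / n < x" "x < (real a + d) / n"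
    by (auto simp: reduced_nbhd_def)
  have "a > 0" "a < n" using a assms by (auto simp: totatives_less in_totatives_iff)
  then have "0 \<le> (real a - d) / n" "(real a + d) / n \<le> 1"
    using assms by (auto simp: field_simps)
  with x show "x \<in> {0..<1}" by auto
qed

lemma fmeasurable_Ioo [simp]: "{a<..<b::real} \<in> fmeasurable lborel"
  using fmeasurable_box[of a b] by simp

lemma measure_reduced_nbhd:
  assumes "0 \<le> d" "d \<le> 1 / 2"
  shows "measure lborel (reduced_nbhd n d) = real (totient n) * (2 * d / n)"
proof -
  have "disjoint_family_on (\<lambda>a. {(real a - d) / n <..< (real a + d) / n}) (totatives n)"
  proof (unfold disjoint_family_on_def, intro ballI impI)
    fix a b assume "a \<in> totatives n" "b \<in> totatives n" "a \<noteq> b"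
    moreover have "{(real a - d) / n <..< (real a + d) / n} \<inter> {(real b - d) / n <..< (real b + d) / n} = {}"
      if "a < b" "n > 0" for a b
    proof -
      have "real a + d \<le> real b - d" using that assms by linarith
      then have "(real a + d) / n \<le> (real b - d) / n" by (simp add: divide_right_mono)
      then show ?thesis by auto
    qed
    moreover have "n > 0" using \<open>a \<in> totatives n\<close> by (cases n) auto
    ultimately show "{(real a - d) / n <..< (real a + d) / n} \<inter> {(real b - d) / n <..< (real b + d) / n} = {}"
      by (metis Int_commute nat_neq_iff)
  qed
  then have "measure lborel (reduced_nbhd n d)
    = (\<Sum>a\<in>totatives n. measure lborel {(real a - d) / n <..< (real a + d) / n})"
    unfolding reduced_nbhd_def by (intro measure_finite_Union)
      (auto simp: fmeasurableD2[OF fmeasurable_Ioo, unfolded infinity_ennreal_def])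
  also have "\<dots> = (\<Sum>a\<in>totatives n. 2 * d / n)"
  proof (rule sum.cong)
    fix a
    have "(real a - d) / n \<le> (real a + d) / n" using assms by (simp add: divide_right_mono)
    then show "measure lborel {(real a - d) / n <..< (real a + d) / n} = 2 * d / n"
      by (simp add: diff_divide_distrib add_divide_distrib)
  qed simp
  finally show ?thesis by (simp add: totient_def)
qed

text \<open>Leaving out 0 removes the additive constant from the count. Overlaps of the
  neighbourhoods can then be bounded by a product of the radii, however small these are.\<close>

lemma card_nonzero_int_less:
  assumes "r \<ge> 0"
  shows "finite {k::int. k \<noteq> 0 \<and> \<bar>real_of_int k\<bar> < r}"
    and "real (card {k::int. k \<noteq> 0 \<and> \<bar>real_of_int k\<bar> < r}) \<le> 2 * r"
proof -
  let ?A = "{k::int. k \<noteq> 0 \<and> \<bar>real_of_int k\<bar> < r}"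
  have sub: "?A \<subseteq> {- \<lfloor>r\<rfloor>..\<lfloor>r\<rfloor>} - {0}"
    by (auto simp: abs_less_iff le_floor_iff minus_le_iff)
  then show "finite ?A" by (rule finite_subset) auto
  have "card ?A \<le> card ({- \<lfloor>r\<rfloor>..\<lfloor>r\<rfloor>} - {0})" by (rule card_mono[OF _ sub]) auto
  also have "\<dots> = nat (2 * \<lfloor>r\<rfloor>)" using assms by (subst card_Diff_singleton) auto
  finally have "real (card ?A) \<le> real (nat (2 * \<lfloor>r\<rfloor>))" by (rule of_nat_mono)
  also have "\<dots> \<le> 2 * r" using assms by simp
  finally show "real (card ?A) \<le> 2 * r" .
qed

text \<open>A value \<open>an - bm\<close> is a multiple \<open>kg\<close> of \<open>g = gcd m n\<close>, nonzero because distinct denominators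
  have no reduced fraction in common; it determines \<open>a\<close> modulo \<open>m/g\<close>, and \<open>b\<close> in terms of \<open>a\<close>.\<close>

lemma card_close_reduced_fractions:
  assumes m: "m \<ge> 2" and n: "n \<ge> 2" and "m \<noteq> n" and "D \<ge> 0"
  shows "real (card {(a, b) \<in> totatives m \<times> totatives n. \<bar>real a * n - real b * m\<bar> < D}) \<le> 2 * D"
proof -
  define g where "g = gcd m n"
  have g: "g > 0" using m by (simp add: g_def)
  obtain m' n' where m': "m = g * m'" and n': "n = g * n'" and cop: "coprime m' n'"
    using gcd_coprime_exists[of m n] g unfolding g_def by (metis mult.commute neq0_conv)
  have pos: "m' > 0" "n' > 0" using m n m' n' by (auto intro!: Nat.gr0I)
  define P where "P = {(a, b) \<in> totatives m \<times> totatives n. \<bar>real a * n - real b * m\<bar> < D}"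
  define K where "K = {k::int. k \<noteq> 0 \<and> \<bar>real_of_int k\<bar> < D / g}"
  define f where "f = (\<lambda>(a, b). (int a * int n' - int b * int m', a div m'))"
  have "f ` P \<subseteq> K \<times> {..<g}"
  proof (rule image_subsetI)
    fix p assume "p \<in> P"
    then obtain a b where p: "p = (a, b)" and "(a, b) \<in> P" by (metis surj_pair)
    then have a: "a \<in> totatives m" and b: "b \<in> totatives n" and D: "\<bar>real a * n - real b * m\<bar> < D"
      by (auto simp: P_def)
    have "real a * n - real b * m = real g * of_int (int a * int n' - int b * int m')"
      by (simp add: m' n' algebra_simps)
    then have small: "\<bar>real_of_int (int a * int n' - int b * int m')\<bar> < D / g"
      using D g unfolding abs_mult by (simp add: pos_less_divide_eq mult.commute)
    have "a * n \<noteq> b * m"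
    proof
      assume eq: "a * n = b * m"
      have "coprime a m" "coprime b n" using a b by (auto simp: in_totatives_iff)
      moreover have "m dvd a * n" "n dvd b * m" using eq by (metis dvd_triv_right)+
      ultimately have "m dvd n" "n dvd m"
        by (metis coprime_commute coprime_dvd_mult_right_iff)+
      then show False using \<open>m \<noteq> n\<close> by (simp add: dvd_antisym)
    qed
    then have "int a * int n' - int b * int m' \<noteq> 0"
      by (simp add: m' n' flip: of_nat_mult)
    moreover have "a div m' < g"
    proof -
      have "a < m" using a m by (auto simp: totatives_less)
      then show ?thesis using m' by (simp add: less_mult_imp_div_less)
    qed
    ultimately show "f p \<in> K \<times> {..<g}" using small by (auto simp: p f_def K_def)
  qed
  moreover have "inj_on f P"
  proof (rule inj_onI)
    fix p p' assume "f p = f p'"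
    moreover obtain a b a' b' where p: "p = (a, b)" "p' = (a', b')" by (metis surj_pair)
    ultimately have eq: "int a * int n' - int b * int m' = int a' * int n' - int b' * int m'"
      and q: "a div m' = a' div m'" by (auto simp: f_def)
    have "(int a - int a') * int n' = (int b - int b') * int m'" using eq by (simp add: algebra_simps)
    then have "int m' dvd (int a - int a') * int n'" by simp
    then have "int m' dvd int a - int a'"
      using cop by (simp add: coprime_dvd_mult_left_iff)
    then have "a mod m' = a' mod m'"
      by (metis mod_eq_dvd_iff of_nat_eq_iff zmod_int)
    with q have "a = a'" by (metis div_mult_mod_eq)
    with eq pos show "p = p'" by (simp add: p)
  qed
  moreover have fin: "finite K" unfolding K_def using \<open>D \<ge> 0\<close> by (intro card_nonzero_int_less) auto
  ultimately have "card P \<le> card (K \<times> {..<g})"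
    by (metis card_inj_on_le finite_SigmaI finite_lessThan)
  then have "real (card P) \<le> real (card K) * g"
    by (simp add: card_cartesian_product flip: of_nat_mult)
  also have "\<dots> \<le> 2 * (D / g) * g"
    using \<open>D \<ge> 0\<close> unfolding K_def by (intro mult_right_mono card_nonzero_int_less) auto
  also have "\<dots> = 2 * D" using g by simp
  finally show ?thesis by (simp add: P_def)
qed

text \<open>Intervals around a/m and b/n meet only if |an - bm| < D = nx + my, which leaves at most
  2D pairs, each with an intersection no longer than the shorter interval. If x/m \<le> y/n, then D
  \<le> 2my while the shorter length is 2x/m, and m cancels; the other case is symmetric.\<close>

lemma measure_reduced_nbhd_Int:
  assumes m: "m \<ge> 2" and n: "n \<ge> 2" and "m \<noteq> n" and x: "0 \<le> x" and y: "0 \<le> y"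
  shows "measure lborel (reduced_nbhd m x \<inter> reduced_nbhd n y) \<le> 8 * x * y"
proof -
  define I where "I = (\<lambda>a. {(real a - x) / m <..< (real a + x) / m})"
  define J where "J = (\<lambda>b. {(real b - y) / n <..< (real b + y) / n})"
  define D where "D = real n * x + real m * y"
  define P where "P = {(a, b) \<in> totatives m \<times> totatives n. \<bar>real a * n - real b * m\<bar> < D}"
  define v where "v = min (2 * x / m) (2 * y / n)"
  have D: "D \<ge> 0" using x y by (simp add: D_def)
  have finP: "finite P"
    by (rule finite_subset[of _ "totatives m \<times> totatives n"]) (auto simp: P_def)
  have sub: "reduced_nbhd m x \<inter> reduced_nbhd n y \<subseteq> (\<Union>(a, b)\<in>P. I a \<inter> J b)"
  proof
    fix t assume "t \<in> reduced_nbhd m x \<inter> reduced_nbhd n y"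
    then obtain a b where ab: "a \<in> totatives m" "b \<in> totatives n" "t \<in> I a" "t \<in> J b"
      by (auto simp: reduced_nbhd_def I_def J_def)
    have "\<bar>real m * t - real a\<bar> < x" "\<bar>real n * t - real b\<bar> < y"
      using ab m n by (auto simp: I_def J_def field_simps abs_less_iff)
    then have "\<bar>real n * (real m * t - real a)\<bar> < real n * x" "\<bar>real m * (real n * t - real b)\<bar> < real m * y"
      using m n by (auto simp: abs_mult)
    then have "\<bar>real a * n - real b * m\<bar> < D" by (simp add: D_def algebra_simps abs_less_iff)
    with ab show "t \<in> (\<Union>(a, b)\<in>P. I a \<inter> J b)" by (auto simp: P_def)
  qed
  have Ia: "I a \<in> fmeasurable lborel" "measure lborel (I a) = 2 * x / m" for a
  proof -
    show "I a \<in> fmeasurable lborel" by (simp add: I_def)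
    have "(real a - x) / m \<le> (real a + x) / m" using x by (simp add: divide_right_mono)
    then show "measure lborel (I a) = 2 * x / m"
      by (simp add: I_def diff_divide_distrib add_divide_distrib)
  qed
  have Jb: "J b \<in> fmeasurable lborel" "measure lborel (J b) = 2 * y / n" for b
  proof -
    show "J b \<in> fmeasurable lborel" by (simp add: J_def)
    have "(real b - y) / n \<le> (real b + y) / n" using y by (simp add: divide_right_mono)
    then show "measure lborel (J b) = 2 * y / n"
      by (simp add: J_def diff_divide_distrib add_divide_distrib)
  qed
  have IJ: "measure lborel (I a \<inter> J b) \<le> v" for a b
    using measure_mono_fmeasurable[of "I a \<inter> J b" "I a" lborel]
      measure_mono_fmeasurable[of "I a \<inter> J b" "J b" lborel] Ia[of a] Jb[of b]
    by (auto simp: v_def fmeasurableD)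
  have fm: "(\<Union>(a, b)\<in>P. I a \<inter> J b) \<in> fmeasurable lborel"
    using finP Ia Jb by (auto intro!: fmeasurable.finite_UN fmeasurable.Int)
  have "measure lborel (reduced_nbhd m x \<inter> reduced_nbhd n y) \<le> measure lborel (\<Union>(a, b)\<in>P. I a \<inter> J b)"
    by (rule measure_mono_fmeasurable[OF sub _ fm]) auto
  also have "\<dots> \<le> (\<Sum>(a, b)\<in>P. measure lborel (I a \<inter> J b))"
    unfolding split_def using finP by (intro measure_UNION_le) (auto simp: I_def J_def)
  also have "\<dots> \<le> (\<Sum>p\<in>P. v)" by (rule sum_mono) (auto simp: IJ)
  also have "\<dots> = real (card P) * v" by simp
  also have "\<dots> \<le> 2 * D * v"
    unfolding P_def using x y D
    by (intro mult_right_mono card_close_reduced_fractions assms) (auto simp: v_def)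
  also have "\<dots> \<le> 8 * x * y"
  proof (cases "x / m \<le> y / n")
    case True
    then have "x / m * (m * n) \<le> y / n * (m * n)" by (rule mult_right_mono) simp
    moreover have "x / m * (m * n) = n * x" "y / n * (m * n) = m * y" using m n by simp_all
    ultimately have "n * x \<le> m * y" by simp
    then have "D \<le> 2 * (m * y)" unfolding D_def by linarith
    moreover have "v \<le> 2 * x / m" by (simp add: v_def)
    ultimately have "2 * D * v \<le> 2 * (2 * (m * y)) * (2 * x / m)"
      using x y D by (intro mult_mono) (auto simp: v_def)
    then show ?thesis using m by (simp add: field_simps)
  next
    case False
    then have "y / n * (m * n) \<le> x / m * (m * n)" by (intro mult_right_mono) simp_all
    moreover have "x / m * (m * n) = n * x" "y / n * (m * n) = m * y" using m n by simp_all
    ultimately have "m * y \<le> n * x" by simp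
    then have "D \<le> 2 * (n * x)" unfolding D_def by linarith
    moreover have "v \<le> 2 * y / n" by (simp add: v_def)
    ultimately have "2 * D * v \<le> 2 * (2 * (n * x)) * (2 * y / n)"
      using x y D by (intro mult_mono) (auto simp: v_def)
    then show ?thesis using n by (simp add: field_simps)
  qed
  finally show ?thesis .
qed

text \<open>A Bonferroni inequality. The overlap bound carries the factor 2 because adding a set of
  weight d to total weight s increases the square by the cross term 2ds. The result is useful when
  the total weight is well below 1/c.\<close>

lemma measure_UN_quasi_independent:
  assumes "finite S" and "\<And>i. i \<in> S \<Longrightarrow> A i \<in> fmeasurable M"
    and "\<And>i. i \<in> S \<Longrightarrow> 0 \<le> d i" and "\<And>i. i \<in> S \<Longrightarrow> d i \<le> measure M (A i)"
    and "\<And>i j. i \<in> S \<Longrightarrow> j \<in> S \<Longrightarrow> i \<noteq> j \<Longrightarrow> measure M (A i \<inter> A j) \<le> 2 * c * d i * d j"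
    and "0 \<le> c"
  shows "(\<Sum>i\<in>S. d i) - c * (\<Sum>i\<in>S. d i)\<^sup>2 \<le> measure M (\<Union>i\<in>S. A i)"
  using assms(1-5)
proof (induction S rule: finite_induct)
  case empty
  then show ?case by simp
next
  case (insert x S)
  define s where "s = (\<Sum>i\<in>S. d i)"
  have IH: "s - c * s\<^sup>2 \<le> measure M (\<Union>i\<in>S. A i)"
    unfolding s_def using insert.prems by (intro insert.IH) auto
  have U: "(\<Union>i\<in>S. A i) \<in> fmeasurable M" using insert by (intro fmeasurable.finite_UN) auto
  have "measure M (A x \<inter> (\<Union>i\<in>S. A i)) = measure M (\<Union>i\<in>S. A x \<inter> A i)"
    by (simp only: Int_UN_distrib)
  also have "\<dots> \<le> (\<Sum>i\<in>S. measure M (A x \<inter> A i))"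
    using insert by (intro measure_UNION_le) (auto intro: fmeasurableD)
  also have "\<dots> \<le> (\<Sum>i\<in>S. 2 * c * d x * d i)"
    using insert.prems(4) insert.hyps by (intro sum_mono) auto
  also have "\<dots> = 2 * c * d x * s" by (simp add: s_def sum_distrib_left)
  finally have "measure M (A x \<inter> (\<Union>i\<in>S. A i)) \<le> 2 * c * d x * s" .
  moreover have "measure M (\<Union>i\<in>insert x S. A i)
     = measure M (A x) + measure M (\<Union>i\<in>S. A i) - measure M (A x \<inter> (\<Union>i\<in>S. A i))"
    using measure_Un3[OF _ U, of "A x"] insert.prems by simp
  moreover have "d x \<le> measure M (A x)" using insert.prems by simp
  moreover have "0 \<le> c * (d x)\<^sup>2" using \<open>0 \<le> c\<close> by simp
  ultimately have "d x + s - c * (d x + s)\<^sup>2 \<le> measure M (\<Union>i\<in>insert x S. A i)"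
    using IH by (simp add: power2_eq_square algebra_simps)
  then show ?case using insert.hyps by (simp add: s_def)
qed

text \<open>The first sum to reach c overshoots by at most one term. This fixes the total weight at
  a size where the linear term of the Bonferroni bound dominates the quadratic one.\<close>

lemma not_summable_sum_between:
  fixes d :: "nat \<Rightarrow> real"
  assumes nonneg: "\<And>n. 0 \<le> d n" and "\<not> summable d" and le: "\<And>n. d n \<le> c"
  obtains N where "c \<le> (\<Sum>n=k..<N. d n)" "(\<Sum>n=k..<N. d n) \<le> 2 * c"
proof -
  have c: "0 \<le> c" using nonneg le order_trans by blast
  have "\<exists>N. c \<le> (\<Sum>n=k..<N. d n)"
  proof (rule ccontr)
    assume *: "\<not> ?thesis"
    have "(\<Sum>n<N. d n) \<le> (\<Sum>n<k. d n) + c" for N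
    proof -
      have "(\<Sum>n<N. d n) \<le> (\<Sum>n\<in>{..<k} \<union> {k..<N}. d n)"
        using nonneg by (intro sum_mono2) auto
      also have "\<dots> = (\<Sum>n<k. d n) + (\<Sum>n=k..<N. d n)" by (intro sum.union_disjoint) auto
      also have "\<dots> \<le> (\<Sum>n<k. d n) + c" using * by (simp add: less_imp_le not_le)
      finally show ?thesis .
    qed
    then have "summable d" using nonneg by (intro summableI_nonneg_bounded) auto
    with assms show False by blast
  qed
  then obtain N where N: "c \<le> (\<Sum>n=k..<N. d n)" and least: "\<And>m. m < N \<Longrightarrow> \<not> c \<le> (\<Sum>n=k..<m. d n)"
    using exists_least_iff[of "\<lambda>N. c \<le> (\<Sum>n=k..<N. d n)"] by blast
  have "(\<Sum>n=k..<N. d n) \<le> 2 * c"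
  proof (cases N)
    case (Suc m)
    have "(\<Sum>n=k..<m. d n) \<le> c" using least[of m] Suc by simp
    then show ?thesis using Suc le[of m] c by (cases "k \<le> m") auto
  qed (use c in simp)
  with N that show thesis by blast
qed

lemma not_summable_min:
  fixes d :: "nat \<Rightarrow> real"
  assumes "\<And>n. 0 \<le> d n" and "\<not> summable d" and "c > 0"
  shows "\<not> summable (\<lambda>n. min (d n) c)"
proof
  assume *: "summable (\<lambda>n. min (d n) c)"
  then have "(\<lambda>n. min (d n) c) \<longlonglongrightarrow> 0" by (rule summable_LIMSEQ_zero)
  then have "eventually (\<lambda>n. min (d n) c < c) sequentially" using \<open>c > 0\<close> by (rule order_tendstoD)
  then have "eventually (\<lambda>n. min (d n) c = d n) sequentially" by eventually_elim auto
  with * have "summable d" using summable_cong by fastforce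
  with assms show False by blast
qed

text \<open>The bound of \<open>measure_UN_quasi_independent\<close> does not deteriorate when all radii are
  divided by \<open>k\<close>, so the intersection over all \<open>k\<close> of the resulting sets still has positive
  measure; unlike a single limsup set, this intersection is invariant under multiplication by
  integers.\<close>

theorem duffin_schaeffer:
  fixes d :: "nat \<Rightarrow> real"
  assumes nonneg: "\<And>n. 0 \<le> d n" and div: "\<not> summable d"
    and tot: "\<And>n. d n > 0 \<Longrightarrow> n \<le> 2 * totient n"
  shows "AE \<beta> in lborel. infinite {n. dist_int (real n * \<beta>) < d n}"
proof -
  \<comment> \<open>One index k both pushes n to infinity and shrinks the radius, so that
    \<open>F\<close> is a decreasing intersection.\<close>
  define U where "U = (\<lambda>k::nat. {\<beta>. \<exists>n\<ge>k. real (Suc k) * dist_int (real n * \<beta>) < d n})"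
  define F where "F = (\<Inter>k. U k)"
  have U_meas[measurable]: "U k \<in> sets borel" for k unfolding U_def by measurable
  have F_meas[measurable]: "F \<in> sets borel" unfolding F_def by measurable
  have decU: "U (Suc k) \<subseteq> U k" for k
  proof
    fix x assume "x \<in> U (Suc k)"
    then obtain n where n: "n \<ge> Suc k" "real (Suc (Suc k)) * dist_int (real n * x) < d n"
      by (auto simp: U_def)
    have "real (Suc k) * dist_int (real n * x) \<le> real (Suc (Suc k)) * dist_int (real n * x)"
      by (intro mult_right_mono) auto
    with n show "x \<in> U k" unfolding U_def by (auto intro!: exI[of _ n])
  qed
  have "x + 1 \<in> U k \<longleftrightarrow> x \<in> U k" for x k
  proof -
    have "dist_int (real n * (x + 1)) = dist_int (real n * x)" for n
      using dist_int_add_int[of "real n * x" "int n"] by (simp add: algebra_simps)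
    then show ?thesis by (simp add: U_def)
  qed
  then have per: "x + 1 \<in> F \<longleftrightarrow> x \<in> F" for x by (simp add: F_def)
  have inv: "real l * x \<in> F" if "x \<in> F" for l x
  proof -
    have "real l * x \<in> U k" for k
    proof -
      \<comment> \<open>Multiplying x by l costs a factor l in the distance. This K absorbs it,
        since \<open>Suc K\<close> \<ge> \<open>Suc k * l\<close>, and it is still at least
        k.\<close>
      define K where "K = Suc k * Suc l"
      have "x \<in> U K" using that by (simp add: F_def)
      then obtain n where n: "n \<ge> K" "real (Suc K) * dist_int (real n * x) < d n"
        by (auto simp: U_def)
      have "real (Suc k) * dist_int (real n * (real l * x))
          \<le> real (Suc k) * (real l * dist_int (real n * x))"
        using dist_int_of_nat_mult_le[of l "real n * x"]
        by (intro mult_left_mono) (auto simp: mult.left_commute)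
      also have "\<dots> = real (Suc k * l) * dist_int (real n * x)"
        by (simp only: of_nat_mult mult.assoc)
      also have "\<dots> \<le> real (Suc K) * dist_int (real n * x)"
        by (intro mult_right_mono of_nat_mono) (auto simp: K_def)
      finally have "real (Suc k) * dist_int (real n * (real l * x)) < d n" using n by linarith
      moreover have "n \<ge> k" using n by (simp add: K_def)
      ultimately show ?thesis unfolding U_def by blast
    qed
    then show ?thesis by (simp add: F_def)
  qed
  have meas_U: "1 / 64 \<le> measure lborel (U k \<inter> {0..<1})" for k
  proof -
    \<comment> \<open>Truncation at 1/32 allows a total s between 1/32 and 1/16. With c = 4 from the
      overlap bound 8xy, s(1 - 4s) \<ge> 3/128 > 1/64, for every k.\<close>
    define e where "e = (\<lambda>n. min (d n) (1 / 32) / real (Suc k))"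
    have e_nonneg: "0 \<le> e n" for n using nonneg by (simp add: e_def)
    have "min (d n) (1 / 32) / real (Suc k) \<le> (1 / 32) / 1" for n
      using nonneg by (intro frac_le) auto
    then have e_le: "e n \<le> 1 / 32" for n by (simp add: e_def)
    have "\<not> summable e"
    proof
      assume "summable e"
      then have "summable (\<lambda>n. real (Suc k) * e n)" by (rule summable_mult)
      then have "summable (\<lambda>n. min (d n) (1 / 32))" by (simp add: e_def del: of_nat_Suc)
      with not_summable_min[OF nonneg div, of "1 / 32"] show False by simp
    qed
    then obtain N where N: "1 / 32 \<le> (\<Sum>n=max k 2..<N. e n)" "(\<Sum>n=max k 2..<N. e n) \<le> 2 * (1 / 32)"
      using not_summable_sum_between[of e "1 / 32" "max k 2"] e_nonneg e_le by blast
    define S where "S = {max k 2..<N}"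
    define s where "s = (\<Sum>n\<in>S. e n)"
    have fm: "reduced_nbhd n (e n) \<in> fmeasurable lborel" if "n \<ge> 2" for n
      by (rule fmeasurableI2[of "{0..1}"])
        (use reduced_nbhd_subset[OF that, of "e n"] e_le[of n] fmeasurable_cbox[of 0 "1::real"] in auto)
    have "s - 4 * s\<^sup>2 \<le> measure lborel (\<Union>n\<in>S. reduced_nbhd n (e n))"
      unfolding s_def
    proof (rule measure_UN_quasi_independent)
      fix n assume n: "n \<in> S"
      \<comment> \<open>The measure is 2 e(n) \<phi>(n)/n, and \<phi>(n) \<ge> n/2 wherever e(n) is
        nonzero.\<close>
      show "e n \<le> measure lborel (reduced_nbhd n (e n))"
      proof (cases "d n = 0")
        case False
        then have "real n \<le> 2 * real (totient n)"
          using tot[of n] nonneg[of n] by linarith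
        then have "e n * real n \<le> e n * (2 * real (totient n))"
          by (rule mult_left_mono) (rule e_nonneg)
        moreover have "n > 0" using n by (auto simp: S_def)
        ultimately show ?thesis using e_nonneg[of n] e_le[of n]
          by (simp add: measure_reduced_nbhd field_simps)
      qed (simp add: e_def)
    next
      fix m n assume "m \<in> S" "n \<in> S" "m \<noteq> n"
      then show "measure lborel (reduced_nbhd m (e m) \<inter> reduced_nbhd n (e n)) \<le> 2 * 4 * e m * e n"
        using measure_reduced_nbhd_Int[of m n "e m" "e n"] e_nonneg by (auto simp: S_def)
    qed (auto simp: S_def fm e_nonneg)
    moreover have "1 / 64 \<le> s - 4 * s\<^sup>2"
    proof -
      have s: "1 / 32 \<le> s" "s \<le> 1 / 16" using N by (simp_all add: s_def S_def)
      then have "(1 / 32) * (3 / 4) \<le> s * (1 - 4 * s)" by (intro mult_mono) auto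
      then show ?thesis by (simp add: power2_eq_square algebra_simps)
    qed
    moreover have "measure lborel (\<Union>n\<in>S. reduced_nbhd n (e n)) \<le> measure lborel (U k \<inter> {0..<1})"
    proof (rule measure_mono_fmeasurable)
      show "(\<Union>n\<in>S. reduced_nbhd n (e n)) \<subseteq> U k \<inter> {0..<1}"
      proof
        fix x assume "x \<in> (\<Union>n\<in>S. reduced_nbhd n (e n))"
        then obtain n where n: "n \<ge> k" "n \<ge> 2" "x \<in> reduced_nbhd n (e n)" by (auto simp: S_def)
        have "dist_int (real n * x) < e n" using n by (intro dist_int_reduced_nbhd)
        then have "real (Suc k) * dist_int (real n * x) < min (d n) (1 / 32)"
          by (simp add: e_def field_simps del: of_nat_Suc)
        moreover have "x \<in> {0..<1}"
          using reduced_nbhd_subset[of n "e n"] n e_le[of n] by auto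
        ultimately show "x \<in> U k \<inter> {0..<1}" using n by (auto simp: U_def)
      qed
    qed auto
    ultimately show ?thesis by linarith
  qed
  have "(\<lambda>k. measure lborel (U k \<inter> {0..<1})) \<longlonglongrightarrow> measure lborel (\<Inter>k. U k \<inter> {0..<1})"
    using decU by (intro Lim_measure_decseq decseq_SucI) (auto intro!: fmeasurableD2 fmeasurable_Int_Ico)
  then have "1 / 64 \<le> measure lborel (\<Inter>k. U k \<inter> {0..<1})"
    using meas_U by (intro LIMSEQ_le_const) auto
  also have "(\<Inter>k. U k \<inter> {0..<1}) = F \<inter> {0..<1}" by (auto simp: F_def)
  finally have "0 < measure lborel (F \<inter> {0..<1})" by linarith
  from AE_periodic_invariant[OF F_meas per inv this] have "AE \<beta> in lborel. \<beta> \<in> F" .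
  then show ?thesis
  proof eventually_elim
    case (elim \<beta>)
    show ?case unfolding infinite_nat_iff_unbounded_le
    proof
      fix m
      have "\<beta> \<in> U m" using elim by (simp add: F_def)
      then obtain n where n: "n \<ge> m" "real (Suc m) * dist_int (real n * \<beta>) < d n"
        by (auto simp: U_def)
      have "1 * dist_int (real n * \<beta>) \<le> real (Suc m) * dist_int (real n * \<beta>)"
        by (intro mult_right_mono) auto
      with n show "\<exists>n\<ge>m. n \<in> {n. dist_int (real n * \<beta>) < d n}" by auto
    qed
  qed
qed

section \<open>Bohr sets\<close>

lemma card_int_between:
  fixes x y :: real
  shows "finite {c::int. x \<le> c \<and> c \<le> y}"
    and "y - x - 1 \<le> real (card {c::int. x \<le> c \<and> c \<le> y})"
    and "x \<le> y \<Longrightarrow> real (card {c::int. x \<le> c \<and> c \<le> y}) \<le> y - x + 1"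
proof -
  have eq: "{c::int. x \<le> c \<and> c \<le> y} = {\<lceil>x\<rceil>..\<lfloor>y\<rfloor>}"
    by (auto simp: ceiling_le_iff le_floor_iff)
  show "finite {c::int. x \<le> c \<and> c \<le> y}" by (simp add: eq)
  show "y - x - 1 \<le> real (card {c::int. x \<le> c \<and> c \<le> y})"
    unfolding eq by simp linarith
  show "real (card {c::int. x \<le> c \<and> c \<le> y}) \<le> y - x + 1" if "x \<le> y"
    unfolding eq using that by simp linarith
qed

definition bohr_set :: "real \<Rightarrow> real \<Rightarrow> real \<Rightarrow> nat set" where
  "bohr_set \<alpha> \<gamma> \<rho> = {k. dist_int (real k * \<alpha> - \<gamma>) \<le> \<rho>}"

text \<open>On a block of length q, the number q r \<alpha> stays within 1 of the integer ra. If a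
  and q are coprime, these integers run once through the residues modulo q, so counting r becomes
  counting integers near q\<gamma>.\<close>

lemma rational_approx_error:
  assumes "\<bar>real q * \<alpha> - of_int a\<bar> \<le> 1 / q" "r < q"
  shows "\<bar>real q * (real r * \<alpha>) - of_int (int r * a)\<bar> \<le> 1"
proof -
  have "\<bar>real q * (real r * \<alpha>) - of_int (int r * a)\<bar> = real r * \<bar>real q * \<alpha> - of_int a\<bar>"
  proof -
    have "real q * (real r * \<alpha>) - of_int (int r * a) = real r * (real q * \<alpha> - of_int a)"
      by (simp add: algebra_simps)
    then show ?thesis by (simp add: abs_mult)
  qed
  also have "\<dots> \<le> real q * (1 / q)" using assms by (intro mult_mono) auto
  also have "\<dots> \<le> 1" by simp
  finally show ?thesis .
qed

text \<open>Each r is sent to the representative of ra modulo q lying within q\<rho> + 1 of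
  q\<gamma>. Coprimality makes this injective, and an interval of length 2q\<rho> + 2 holds at most
  2q\<rho> + 3 integers.\<close>

lemma card_bohr_set_block_le:
  assumes cop: "coprime a (int q)" and q: "q > 0" and ap: "\<bar>real q * \<alpha> - of_int a\<bar> \<le> 1 / q"
    and "0 \<le> \<rho>"
  shows "real (card (bohr_set \<alpha> \<gamma> \<rho> \<inter> {..<q})) \<le> 2 * real q * \<rho> + 3"
proof -
  define R where "R = bohr_set \<alpha> \<gamma> \<rho> \<inter> {..<q}"
  define C where "C = {c::int. q * \<gamma> - q * \<rho> - 1 \<le> c \<and> c \<le> q * \<gamma> + q * \<rho> + 1}"
  define f where "f = (\<lambda>r. int r * a - int q * round (real r * \<alpha> - \<gamma>))"
  have "f ` R \<subseteq> C"
  proof (rule image_subsetI)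
    fix r assume r: "r \<in> R"
    then have "\<bar>real r * \<alpha> - \<gamma> - of_int (round (real r * \<alpha> - \<gamma>))\<bar> \<le> \<rho>" and "r < q"
      by (auto simp: R_def bohr_set_def dist_int_altdef)
    then have "real q * \<bar>real r * \<alpha> - \<gamma> - of_int (round (real r * \<alpha> - \<gamma>))\<bar> \<le> real q * \<rho>"
      by (intro mult_left_mono) auto
    then have "\<bar>real q * (real r * \<alpha> - \<gamma> - of_int (round (real r * \<alpha> - \<gamma>)))\<bar> \<le> real q * \<rho>"
      by (simp add: abs_mult)
    with rational_approx_error[OF ap \<open>r < q\<close>] show "f r \<in> C"
      by (simp add: f_def C_def algebra_simps abs_le_iff)
  qed
  moreover have "inj_on f R"
  proof (rule inj_onI)
    fix r s assume r: "r \<in> R" "s \<in> R" and "f r = f s"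
    then have "(int r - int s) * a = int q * (round (real r * \<alpha> - \<gamma>) - round (real s * \<alpha> - \<gamma>))"
      by (simp add: f_def algebra_simps)
    then have "int q dvd (int r - int s) * a" by simp
    then have "int q dvd int r - int s"
      using cop by (simp add: coprime_commute coprime_dvd_mult_left_iff)
    then have "int r mod int q = int s mod int q" by (simp add: mod_eq_dvd_iff)
    then show "r = s" using r by (simp add: R_def)
  qed
  moreover have "finite C" unfolding C_def by (rule card_int_between)
  ultimately have "card R \<le> card C" by (metis card_inj_on_le)
  also have "real (card C) \<le> (q * \<gamma> + q * \<rho> + 1) - (q * \<gamma> - q * \<rho> - 1) + 1"
    unfolding C_def using \<open>0 \<le> \<rho>\<close> by (intro card_int_between) (simp add: add_increasing2)
  also have "\<dots> = 2 * real q * \<rho> + 3" by simp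
  finally show ?thesis by (simp add: R_def)
qed

text \<open>Conversely, each integer c within q\<rho> - 1 of q\<gamma> gives an r with ra congruent
  to c. Here \<rho> \<le> 1/2 keeps any two such c less than q apart, so different c give different
  r.\<close>

lemma card_bohr_set_block_ge:
  assumes cop: "coprime a (int q)" and q: "q > 0" and ap: "\<bar>real q * \<alpha> - of_int a\<bar> \<le> 1 / q"
    and "\<rho> \<le> 1 / 2"
  shows "2 * real q * \<rho> - 3 \<le> real (card (bohr_set \<alpha> \<gamma> \<rho> \<inter> {..<q}))"
proof -
  define R where "R = bohr_set \<alpha> \<gamma> \<rho> \<inter> {..<q}"
  define C where "C = {c::int. q * \<gamma> - (q * \<rho> - 1) \<le> c \<and> c \<le> q * \<gamma> + (q * \<rho> - 1)}"
  obtain a' where a': "[a * a' = 1] (mod int q)" using cop cong_solve_coprime_int by blast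
  define f where "f = (\<lambda>c. nat ((c * a') mod int q))"
  have f: "[int (f c) * a = c] (mod int q)" for c
  proof -
    have "[int (f c) * a = (c * a') * a] (mod int q)"
      using q by (intro cong_mult) (auto simp: f_def cong_def)
    also have "(c * a') * a = c * (a * a')" by (simp add: mult_ac)
    also have "[\<dots> = c * 1] (mod int q)" using a' by (intro cong_mult) auto
    finally show ?thesis by simp
  qed
  have "f ` C \<subseteq> R"
  proof (rule image_subsetI)
    fix c assume c: "c \<in> C"
    have "f c < q" using q by (simp add: f_def nat_less_iff)
    obtain k where k: "int (f c) * a - c = int q * k"
      using f[of c] by (auto simp: cong_iff_dvd_diff)
    have "\<bar>real_of_int c - real q * \<gamma>\<bar> \<le> real q * \<rho> - 1" using c by (auto simp: C_def abs_le_iff)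
    moreover have "real_of_int (int (f c) * a) = real_of_int c + real q * of_int k"
      using arg_cong[OF k, of real_of_int] by simp
    ultimately have "\<bar>real q * (real (f c) * \<alpha> - \<gamma> - of_int k)\<bar> \<le> real q * \<rho>"
      using rational_approx_error[OF ap \<open>f c < q\<close>] unfolding right_diff_distrib by linarith
    then have "\<bar>real (f c) * \<alpha> - \<gamma> - of_int k\<bar> \<le> \<rho>" using q by (simp add: abs_mult)
    with dist_int_le[of "real (f c) * \<alpha> - \<gamma>" k] \<open>f c < q\<close>
    show "f c \<in> R" by (simp add: R_def bohr_set_def)
  qed
  moreover have "inj_on f C"
  proof (rule inj_onI)
    fix c d assume c: "c \<in> C" "d \<in> C" and eq: "f c = f d"
    have "[c = d] (mod int q)" using f[of c] f[of d] eq by (metis cong_sym cong_trans)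
    then have dvd: "int q dvd c - d" by (simp add: cong_iff_dvd_diff)
    have "\<bar>real_of_int c - real_of_int d\<bar> \<le> 2 * (q * \<rho>) - 2" using c by (auto simp: C_def abs_le_iff)
    also have "\<dots> < q"
      using mult_left_mono[OF \<open>\<rho> \<le> 1 / 2\<close>, of "real q"] by linarith
    finally have "\<bar>c - d\<bar> < int q" by linarith
    with dvd_imp_le_int[OF _ dvd] show "c = d" by fastforce
  qed
  moreover have "finite R" by (simp add: R_def)
  ultimately have "card C \<le> card R" by (metis card_inj_on_le)
  have "2 * real q * \<rho> - 3 = (q * \<gamma> + (q * \<rho> - 1)) - (q * \<gamma> - (q * \<rho> - 1)) - 1" by simp
  also have "\<dots> \<le> real (card C)" unfolding C_def by (rule card_int_between)
  also have "\<dots> \<le> real (card R)" using \<open>card C \<le> card R\<close> by simp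
  finally show ?thesis by (simp add: R_def)
qed

text \<open>Moving a block only changes the centre. This is why the estimates for the initial block
  are proved for every \<gamma>: they then hold for blocks at any offset.\<close>

lemma card_bohr_set_shift:
  "card (bohr_set \<alpha> \<gamma> \<rho> \<inter> {X..<X + q}) = card (bohr_set \<alpha> (\<gamma> - real X * \<alpha>) \<rho> \<inter> {..<q})"
proof -
  have "bohr_set \<alpha> \<gamma> \<rho> \<inter> {X..<X + q} = (+) X ` (bohr_set \<alpha> (\<gamma> - real X * \<alpha>) \<rho> \<inter> {..<q})"
  proof (intro equalityI subsetI)
    fix k assume k: "k \<in> bohr_set \<alpha> \<gamma> \<rho> \<inter> {X..<X + q}"
    then have "k = X + (k - X)" by simp
    moreover have "k - X \<in> bohr_set \<alpha> (\<gamma> - real X * \<alpha>) \<rho> \<inter> {..<q}"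
      using k by (auto simp: bohr_set_def algebra_simps)
    ultimately show "k \<in> (+) X ` (bohr_set \<alpha> (\<gamma> - real X * \<alpha>) \<rho> \<inter> {..<q})" by blast
  qed (auto simp: bohr_set_def algebra_simps)
  then show ?thesis by (simp add: card_image)
qed

lemma card_bohr_set_blocks:
  assumes lo: "\<And>\<gamma>. L \<le> real (card (bohr_set \<alpha> \<gamma> \<rho> \<inter> {..<q}))"
    and up: "\<And>\<gamma>. real (card (bohr_set \<alpha> \<gamma> \<rho> \<inter> {..<q})) \<le> U"
  shows "\<And>t X. real t * L \<le> real (card (bohr_set \<alpha> \<gamma> \<rho> \<inter> {X..<X + t * q}))"
    and "\<And>t X. real (card (bohr_set \<alpha> \<gamma> \<rho> \<inter> {X..<X + t * q})) \<le> real t * U"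
proof -
  fix t X
  show "real t * L \<le> real (card (bohr_set \<alpha> \<gamma> \<rho> \<inter> {X..<X + t * q}))"
    and "real (card (bohr_set \<alpha> \<gamma> \<rho> \<inter> {X..<X + t * q})) \<le> real t * U"
  proof (induction t)
    case (Suc t)
    have "bohr_set \<alpha> \<gamma> \<rho> \<inter> {X..<X + Suc t * q} =
        bohr_set \<alpha> \<gamma> \<rho> \<inter> {X..<X + t * q} \<union> bohr_set \<alpha> \<gamma> \<rho> \<inter> {X + t * q..<X + t * q + q}"
      by (auto simp: not_less)
    also have "card \<dots> = card (bohr_set \<alpha> \<gamma> \<rho> \<inter> {X..<X + t * q}) +
        card (bohr_set \<alpha> \<gamma> \<rho> \<inter> {X + t * q..<X + t * q + q})"
      by (intro card_Un_disjoint) auto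
    finally have eq: "real (card (bohr_set \<alpha> \<gamma> \<rho> \<inter> {X..<X + Suc t * q})) =
        real (card (bohr_set \<alpha> \<gamma> \<rho> \<inter> {X..<X + t * q})) +
        real (card (bohr_set \<alpha> (\<gamma> - real (X + t * q) * \<alpha>) \<rho> \<inter> {..<q}))"
      by (simp only: card_bohr_set_shift of_nat_add)
    have suc: "real (Suc t) * z = real t * z + z" for z by (simp add: algebra_simps)
    {
      case 1
      show ?case unfolding eq suc by (rule add_mono[OF Suc.IH(1) lo])
    next
      case 2
      show ?case unfolding eq suc by (rule add_mono[OF Suc.IH(2) up])
    }
  qed simp_all
qed

text \<open>Since q\<rho> \<ge> 3, the errors of 3 per block are absorbed: a block has between
  q\<rho> and 3q\<rho> elements. Since Y \<ge> q, replacing Y by a whole number of blocks, rounded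
  down or up, costs a factor of at most 2.\<close>

lemma card_bohr_set_approx:
  assumes cop: "coprime a (int q)" and q: "q > 0" and ap: "\<bar>real q * \<alpha> - of_int a\<bar> \<le> 1 / q"
    and rho: "3 / q \<le> \<rho>" "\<rho> \<le> 1 / 2" and Y: "q \<le> Y"
  shows "real Y * \<rho> / 2 \<le> real (card (bohr_set \<alpha> \<gamma> \<rho> \<inter> {X..<X + Y}))"
    and "real (card (bohr_set \<alpha> \<gamma> \<rho> \<inter> {X..<X + Y})) \<le> 6 * real Y * \<rho>"
proof -
  define t where "t = Y div q"
  have rho0: "0 \<le> \<rho>" using rho(1) q by (meson divide_nonneg_nonneg of_nat_0_le_iff order_trans zero_le_numeral)
  have q\<rho>: "3 \<le> q * \<rho>" using rho(1) q by (simp add: field_simps)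
  have t1: "t \<ge> 1" using Y q by (simp add: t_def div_greater_zero_iff Suc_le_eq)
  have tq: "t * q \<le> Y" "Y < (t + 1) * q"
    using q by (simp_all add: t_def dividend_less_div_times)
  have t_lo: "real Y \<le> 2 * (t * q)"
  proof -
    have "1 * q \<le> t * q" using t1 by (rule mult_right_mono) simp
    moreover have "Y < t * q + 1 * q" using tq(2) by (simp only: add_mult_distrib)
    ultimately have "Y \<le> 2 * (t * q)" by linarith
    then show ?thesis by (metis of_nat_le_iff of_nat_mult of_nat_numeral)
  qed
  have t_up: "real (t + 1) * q \<le> 2 * Y"
  proof -
    have "(t + 1) * q \<le> 2 * Y" using tq(1) Y by simp
    then show ?thesis by (metis of_nat_le_iff of_nat_mult of_nat_numeral)
  qed
  note blocks = card_bohr_set_blocks[where \<rho> = \<rho> and \<alpha> = \<alpha> and q = q,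
      OF card_bohr_set_block_ge[OF cop q ap rho(2)] card_bohr_set_block_le[OF cop q ap rho0]]
  have "real Y * \<rho> / 2 \<le> (2 * (t * q)) * \<rho> / 2"
    using t_lo rho0 by (intro divide_right_mono mult_right_mono) auto
  also have "\<dots> = t * (q * \<rho>)" by simp
  also have "\<dots> \<le> t * (2 * real q * \<rho> - 3)"
    using q\<rho> by (intro mult_left_mono) (linarith, simp)
  also have "\<dots> \<le> real (card (bohr_set \<alpha> \<gamma> \<rho> \<inter> {X..<X + t * q}))" by (rule blocks)
  also have "\<dots> \<le> real (card (bohr_set \<alpha> \<gamma> \<rho> \<inter> {X..<X + Y}))"
    using tq by (intro of_nat_mono card_mono) auto
  finally show "real Y * \<rho> / 2 \<le> real (card (bohr_set \<alpha> \<gamma> \<rho> \<inter> {X..<X + Y}))" .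
  have "real (card (bohr_set \<alpha> \<gamma> \<rho> \<inter> {X..<X + Y}))
      \<le> real (card (bohr_set \<alpha> \<gamma> \<rho> \<inter> {X..<X + (t + 1) * q}))"
    using tq by (intro of_nat_mono card_mono) auto
  also have "\<dots> \<le> real (t + 1) * (2 * real q * \<rho> + 3)" by (rule blocks)
  also have "\<dots> \<le> real (t + 1) * (3 * (q * \<rho>))"
    using q\<rho> by (intro mult_left_mono) (linarith, simp)
  also have "\<dots> = 3 * \<rho> * (real (t + 1) * q)" by (simp only: mult_ac)
  also have "\<dots> \<le> 3 * \<rho> * (2 * Y)" using t_up rho0 by (intro mult_left_mono) auto
  also have "\<dots> = 6 * real Y * \<rho>" by simp
  finally show "real (card (bohr_set \<alpha> \<gamma> \<rho> \<inter> {X..<X + Y})) \<le> 6 * real Y * \<rho>" .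
qed

text \<open>Dirichlet's theorem gives a denominator q \<le> Y with error below 1/Y. The Diophantine
  condition prevents q from being small: q^w > cY, and the assumption on Y turns this into q\<rho> >
  3.\<close>

lemma card_bohr_set_diophantine:
  assumes c: "c > 0" and dioph: "\<And>q. q \<ge> 1 \<Longrightarrow> c / real q ^ w \<le> dist_int (real q * \<alpha>)"
    and rho: "0 < \<rho>" "\<rho> \<le> 1 / 2" and Y: "3 ^ w \<le> c * real Y * \<rho> ^ w"
  shows "real Y * \<rho> / 2 \<le> real (card (bohr_set \<alpha> \<gamma> \<rho> \<inter> {X..<X + Y}))"
    and "real (card (bohr_set \<alpha> \<gamma> \<rho> \<inter> {X..<X + Y})) \<le> 6 * real Y * \<rho>"
proof -
  have "Y > 0"
  proof (rule ccontr)
    assume "\<not> Y > 0"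
    then have "(3::real) ^ w \<le> 0" using Y by simp
    moreover have "(0::real) < 3 ^ w" by simp
    ultimately show False by linarith
  qed
  then obtain h k where hk: "coprime h k" "0 < k" "k \<le> int Y" "\<bar>of_int k * \<alpha> - of_int h\<bar> < 1 / Y"
    using Dirichlet_approx_coprime[of Y \<alpha>] by auto
  define q where "q = nat k"
  have q: "q > 0" "int q = k" "q \<le> Y" using hk by (auto simp: q_def)
  then have kq: "real_of_int k = real q" by auto
  have "c / real q ^ w < 1 / Y"
    using dioph[of q] dist_int_le[of "real q * \<alpha>" h] hk q kq by simp
  then have "c * Y < real q ^ w" using q \<open>Y > 0\<close> by (simp add: field_simps)
  then have "c * Y * \<rho> ^ w < real q ^ w * \<rho> ^ w" using rho by (intro mult_strict_right_mono) auto
  then have "3 ^ w < (real q * \<rho>) ^ w" using Y by (simp add: power_mult_distrib)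
  then have "3 < real q * \<rho>" using rho by (intro power_less_imp_less_base[of 3 w]) auto
  then have 1: "3 / q \<le> \<rho>" using q by (simp add: field_simps)
  have 2: "\<bar>real q * \<alpha> - of_int h\<bar> \<le> 1 / q"
  proof -
    have "1 / real Y \<le> 1 / real q" using q by (intro divide_left_mono) auto
    then show ?thesis using hk(4) kq by simp
  qed
  have 3: "coprime h (int q)" using hk q by simp
  from card_bohr_set_approx[OF 3 q(1) 2 1 rho(2) q(3)]
  show "real Y * \<rho> / 2 \<le> real (card (bohr_set \<alpha> \<gamma> \<rho> \<inter> {X..<X + Y}))"
    and "real (card (bohr_set \<alpha> \<gamma> \<rho> \<inter> {X..<X + Y})) \<le> 6 * real Y * \<rho>" by auto
qed

section \<open>Integers with large totient in Bohr sets\<close>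

lemma totient_ge_divisor_sum:
  assumes "n > 0"
  shows "real n * (1 - (\<Sum>d | d dvd n \<and> 1 < d. 1 / real d)) \<le> real (totient n)"
proof -
  have fin: "finite {d. d dvd n \<and> 1 < d}"
    by (rule finite_subset[of _ "{d. d dvd n}"]) (use assms in auto)
  \<comment> \<open>A union bound with d = gcd(a, n). Using all divisors d > 1 instead of primes is
    wasteful in general but affordable when all of them are large.\<close>
  have "{0<..n} \<subseteq> totatives n \<union> (\<Union>d\<in>{d. d dvd n \<and> 1 < d}. (*) d ` {0<..n div d})"
  proof
    fix a assume a: "a \<in> {0<..n}"
    show "a \<in> totatives n \<union> (\<Union>d\<in>{d. d dvd n \<and> 1 < d}. (*) d ` {0<..n div d})"
    proof (cases "coprime a n")
      case True
      then show ?thesis using a by (simp add: in_totatives_iff)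
    next
      case False
      define d where "d = gcd a n"
      have "d \<noteq> 1" "d > 0" using False a by (auto simp: d_def coprime_iff_gcd_eq_1)
      then have "1 < d" by linarith
      then have d: "d dvd n" "1 < d" "d dvd a" by (auto simp: d_def)
      then have "a = d * (a div d)" by simp
      moreover have "a div d \<in> {0<..n div d}"
        using a d \<open>d > 0\<close> by (auto intro!: div_le_mono simp: div_greater_zero_iff dvd_imp_le)
      ultimately show ?thesis using d by blast
    qed
  qed
  then have "card {0<..n} \<le> card (totatives n \<union> (\<Union>d\<in>{d. d dvd n \<and> 1 < d}. (*) d ` {0<..n div d}))"
    using fin by (intro card_mono) auto
  also have "\<dots> \<le> totient n + card (\<Union>d\<in>{d. d dvd n \<and> 1 < d}. (*) d ` {0<..n div d})"
    unfolding totient_def by (rule card_Un_le)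
  also have "\<dots> \<le> totient n + (\<Sum>d | d dvd n \<and> 1 < d. card ((*) d ` {0<..n div d}))"
    using fin by (intro add_left_mono card_UN_le)
  also have "\<dots> \<le> totient n + (\<Sum>d | d dvd n \<and> 1 < d. n div d)"
    by (intro add_left_mono sum_mono order_trans[OF card_image_le]) auto
  finally have "real n \<le> real (totient n + (\<Sum>d | d dvd n \<and> 1 < d. n div d))"
    by (simp del: of_nat_add of_nat_sum)
  also have "\<dots> = real (totient n) + (\<Sum>d | d dvd n \<and> 1 < d. real (n div d))" by simp
  also have "(\<Sum>d | d dvd n \<and> 1 < d. real (n div d)) = (\<Sum>d | d dvd n \<and> 1 < d. real n * (1 / real d))"
    by (intro sum.cong) (auto simp: real_of_nat_div)
  finally show ?thesis by (simp add: algebra_simps sum_distrib_left)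
qed

text \<open>Telescoping with 1/d^2 \<le> 1/(d-1) - 1/d.\<close>

lemma sum_inverse_squares_le:
  assumes "a > 0"
  shows "(\<Sum>d\<in>{a<..b}. 1 / (real d)\<^sup>2) \<le> 1 / real a"
proof -
  have "(\<Sum>d\<in>{a<..b}. 1 / (real d)\<^sup>2) \<le> 1 / real a - 1 / real b" if "a \<le> b" for b
    using that
  proof (induction b rule: dec_induct)
    case (step b)
    have "{a<..Suc b} = insert (Suc b) {a<..b}" using step by auto
    then have "(\<Sum>d\<in>{a<..Suc b}. 1 / (real d)\<^sup>2) = 1 / (real (Suc b))\<^sup>2 + (\<Sum>d\<in>{a<..b}. 1 / (real d)\<^sup>2)"
      by simp
    moreover have "1 / (real (Suc b))\<^sup>2 \<le> 1 / real b - 1 / real (Suc b)"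
      using step assms by (simp add: divide_simps power2_eq_square)
    ultimately show ?case using step.IH by linarith
  qed simp
  from this[of b] show ?thesis
    by (cases "a \<le> b") (auto intro: order_trans)
qed

text \<open>If d divides Mk + 1, it is coprime to M, so the admissible k lie in one residue class
  modulo d. Writing k = k0 + dj from the least of them, the condition on j is a Bohr condition for
  dM\<alpha>, whose centre depends on k0.\<close>

lemma card_bohr_progression_divisible_le:
  assumes d: "d > 0"
  obtains \<gamma>' where "card {k \<in> {Y..<2 * Y}. dist_int (real (M * k + 1) * \<alpha> - \<gamma>) \<le> \<rho> \<and> d dvd M * k + 1}
      \<le> card (bohr_set (real (d * M) * \<alpha>) \<gamma>' \<rho> \<inter> {0..<0 + (Y div d + 1)})"
proof -
  define S where "S = {k \<in> {Y..<2 * Y}. dist_int (real (M * k + 1) * \<alpha> - \<gamma>) \<le> \<rho> \<and> d dvd M * k + 1}"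
  have "\<exists>\<gamma>'. card S \<le> card (bohr_set (real (d * M) * \<alpha>) \<gamma>' \<rho> \<inter> {0..<0 + (Y div d + 1)})"
  proof (cases "S = {}")
    case False
    have "finite S" by (simp add: S_def)
    define k0 where "k0 = Min S"
    have k0: "k0 \<in> S" "\<And>k. k \<in> S \<Longrightarrow> k0 \<le> k"
      using False \<open>finite S\<close> by (auto simp: k0_def)
    define \<gamma>' where "\<gamma>' = \<gamma> - real (M * k0 + 1) * \<alpha>"
    define f where "f = (\<lambda>k. (k - k0) div d)"
    have f: "k = k0 + d * f k" if k: "k \<in> S" for k
    proof -
      have dvd: "d dvd M * k + 1" "d dvd M * k0 + 1" using k k0 by (auto simp: S_def)
      have "(M * k + 1) - (M * k0 + 1) = (k - k0) * M"
        using k0(2)[OF k] by (simp add: diff_mult_distrib2 mult.commute)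
      with dvd have "d dvd (k - k0) * M" by (metis dvd_diff_nat)
      moreover have "coprime d M"
      proof (rule coprimeI)
        fix e assume "e dvd d" "e dvd M"
        then have "e dvd M * k + 1" "e dvd M * k" using dvd by (auto intro: dvd_trans)
        then show "is_unit e" using dvd_add_right_iff[of e "M * k" 1] by simp
      qed
      ultimately have "d dvd k - k0" by (simp add: coprime_dvd_mult_left_iff)
      then show ?thesis using k0(2)[OF k] by (simp add: f_def)
    qed
    have "f ` S \<subseteq> bohr_set (real (d * M) * \<alpha>) \<gamma>' \<rho> \<inter> {0..<0 + (Y div d + 1)}"
    proof (rule image_subsetI)
      fix k assume k: "k \<in> S"
      have "k - k0 \<le> Y" using k k0(1) by (auto simp: S_def)
      then have "f k \<le> Y div d" unfolding f_def by (rule div_le_mono)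
      have "real k = real k0 + real d * real (f k)"
        using arg_cong[OF f[OF k], of real] by simp
      then have "real (f k) * (real (d * M) * \<alpha>) - \<gamma>' = real (M * k + 1) * \<alpha> - \<gamma>"
        by (simp add: \<gamma>'_def algebra_simps)
      moreover have "dist_int (real (M * k + 1) * \<alpha> - \<gamma>) \<le> \<rho>" using k by (simp add: S_def)
      ultimately have "f k \<in> bohr_set (real (d * M) * \<alpha>) \<gamma>' \<rho>" by (simp only: bohr_set_def mem_Collect_eq)
      with \<open>f k \<le> Y div d\<close> show "f k \<in> bohr_set (real (d * M) * \<alpha>) \<gamma>' \<rho> \<inter> {0..<0 + (Y div d + 1)}"
        by simp
    qed
    moreover have "inj_on f S" by (rule inj_onI) (metis f)
    ultimately have "card S \<le> card (bohr_set (real (d * M) * \<alpha>) \<gamma>' \<rho> \<inter> {0..<0 + (Y div d + 1)})"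
      by (metis card_inj_on_le finite_Int finite_atLeastLessThan)
    then show ?thesis by blast
  qed simp
  then show thesis using that by (auto simp: S_def)
qed

lemma dist_int_le_half: "dist_int x \<le> 1 / 2"
  using of_int_round_abs_le[of x] by (simp add: dist_int_altdef abs_minus_commute)

text \<open>Every divisor \<open>d > 1\<close> of \<open>Mk + 1\<close> exceeds 192. The Bohr set has about \<open>Y\<rho>\<close> elements, and
  about \<open>Y\<rho>/d\<close> of them are counted by \<open>d\<close>, so on average the sum of \<open>1/d\<close> over the divisors
  \<open>d > 1\<close> of \<open>Mk + 1\<close> is small. The range of \<open>d\<close> beyond a multiple of \<open>1/\<rho>\<close>, where
  equidistribution is not available, contributes little even when the condition on \<open>\<alpha>\<close> is
  dropped.\<close>

lemma card_bohr_progression_totient_ge: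
  assumes c: "c > 0" and dioph: "\<And>q. q \<ge> 1 \<Longrightarrow> c / real q ^ w \<le> dist_int (real q * \<alpha>)"
    and M: "M > 0" "\<And>d. 0 < d \<Longrightarrow> d \<le> 192 \<Longrightarrow> d dvd M"
    and rho: "0 < \<rho>" "\<rho> \<le> 1 / 2"
    and Y: "3 ^ w * (49 * real M) ^ (w + 1) * real M ^ w \<le> c * real Y * \<rho> ^ (2 * w + 1)"
  shows "real Y * \<rho> / 4 \<le> real (card {k \<in> {Y..<2 * Y}. dist_int (real (M * k + 1) * \<alpha> - \<gamma>) \<le> \<rho> \<and>
      M * k + 1 \<le> 2 * totient (M * k + 1)})"
proof -
  define B where "B = {k \<in> {Y..<2 * Y}. dist_int (real (M * k + 1) * \<alpha> - \<gamma>) \<le> \<rho>}"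
  define D where "D = nat \<lceil>48 * real M / \<rho>\<rceil>"
  have finB: "finite B" by (simp add: B_def)
  have c1: "c \<le> 1" using dioph[of 1] dist_int_le_half[of \<alpha>] by simp
  have M1: "1 \<le> real M" using M by simp
  have D_lo: "48 * real M / \<rho> \<le> D" unfolding D_def by (rule real_nat_ceiling_ge)
  have D_up: "D \<le> 49 * real M / \<rho>"
  proof -
    have "real D \<le> 48 * real M / \<rho> + 1"
    proof -
      have "0 \<le> 48 * real M / \<rho>" using rho by simp
      then have "real D = of_int \<lceil>48 * real M / \<rho>\<rceil>" unfolding D_def by (subst of_nat_nat) auto
      then show ?thesis by linarith
    qed
    also have "1 \<le> real M / \<rho>" using rho M1 by (simp add: field_simps)
    finally show ?thesis by (simp add: field_simps)
  qed
  have D1: "D \<ge> 1"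
  proof -
    have "0 < 48 * real M / \<rho>" using M rho by simp
    with D_lo have "0 < real D" by linarith
    then show ?thesis by simp
  qed
  \<comment> \<open>The worst case d = D of \<open>key_d\<close>, which is the hypothesis of
    \<open>card_bohr_set_diophantine\<close> for dM\<alpha> and length Y/d. Since D has order
    M/\<rho>, the factor D^(w+1) costs \<rho>^-(w+1), which together with \<rho>^w explains the
    exponent 2w + 1.\<close>
  have key: "3 ^ w * real D ^ (w + 1) * real M ^ w \<le> c * real Y * \<rho> ^ w"
  proof -
    have "3 ^ w * real D ^ (w + 1) * real M ^ w \<le> 3 ^ w * (49 * real M / \<rho>) ^ (w + 1) * real M ^ w"
      using D_up by (intro mult_right_mono mult_left_mono power_mono) auto
    also have "\<dots> = (3 ^ w * (49 * real M) ^ (w + 1) * real M ^ w) / \<rho> ^ (w + 1)"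
      by (simp add: power_divide)
    also have "\<dots> \<le> (c * real Y * \<rho> ^ (2 * w + 1)) / \<rho> ^ (w + 1)"
      using Y rho by (intro divide_right_mono) auto
    also have "\<dots> = c * real Y * \<rho> ^ w"
    proof -
      have "\<rho> ^ (2 * w + 1) = \<rho> ^ w * \<rho> ^ (w + 1)" by (simp flip: power_add add: mult_2)
      then show ?thesis using rho by simp
    qed
    finally show ?thesis .
  qed
  have key_d: "3 ^ w \<le> c / real (d * M) ^ w * (real Y / d) * \<rho> ^ w" if d: "1 \<le> d" "d \<le> D" for d
  proof -
    have "3 ^ w * (real (d * M) ^ w * real d) = 3 ^ w * real d ^ (w + 1) * real M ^ w"
      by (simp add: power_mult_distrib)
    also have "\<dots> \<le> 3 ^ w * real D ^ (w + 1) * real M ^ w"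
      using d by (intro mult_right_mono mult_left_mono power_mono) auto
    also note key
    finally have "3 ^ w * (real (d * M) ^ w * real d) \<le> c * real Y * \<rho> ^ w" .
    moreover have "0 < real (d * M) ^ w * real d" using d M by simp
    ultimately have "3 ^ w \<le> (c * real Y * \<rho> ^ w) / (real (d * M) ^ w * real d)"
      by (simp only: pos_le_divide_eq)
    then show ?thesis by simp
  qed
  have dioph_d: "c / real (d * M) ^ w / real q ^ w \<le> dist_int (real q * (real (d * M) * \<alpha>))"
    if "d \<ge> 1" "q \<ge> 1" for d q
    using dioph[of "q * (d * M)"] that M by (simp add: power_mult_distrib mult_ac)
  have c_d: "0 < c / real (d * M) ^ w" if "d \<ge> 1" for d using that c M by simp
  have cardB: "real Y * \<rho> / 2 \<le> real (card B)"
  proof -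
    have "B = bohr_set (real (1 * M) * \<alpha>) (\<gamma> - \<alpha>) \<rho> \<inter> {Y..<Y + Y}"
      by (auto simp: B_def bohr_set_def algebra_simps)
    moreover have "3 ^ w \<le> c / real (1 * M) ^ w * real Y * \<rho> ^ w" using key_d[of 1] D1 by simp
    ultimately show ?thesis
      using card_bohr_set_diophantine(1)[OF c_d dioph_d rho, of 1] by simp
  qed
  have DY: "D \<le> Y"
  proof -
    have "real D \<le> real D ^ (w + 1)" using D1 by (intro self_le_power) auto
    also have "\<dots> = 1 * real D ^ (w + 1) * 1" by simp
    also have "\<dots> \<le> 3 ^ w * real D ^ (w + 1) * real M ^ w"
      using M1 by (intro mult_mono) auto
    also note key
    also have "c * real Y * \<rho> ^ w \<le> 1 * real Y * 1"
      using c c1 rho by (intro mult_mono power_le_one) auto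
    finally show ?thesis by simp
  qed
  define N where "N = (\<lambda>d. real (card {k \<in> B. d dvd M * k + 1}))"
  \<comment> \<open>The number of j is only bounded by Y/d + 1. The extra 1 is at most Y/d when d
    \<le> D \<le> Y, and at most 2MY/d for every d that can divide some Mk + 1.\<close>
  have N_le: "N d / d \<le> 12 * real Y * \<rho> * (1 / (real d)\<^sup>2) +
      (if D < d then 3 * real M * real Y * (1 / (real d)\<^sup>2) else 0)" if d: "192 < d" "d \<le> 2 * M * Y" for d
  proof -
    have d0: "d > 0" using d by simp
    obtain \<gamma>' where "card {k \<in> {Y..<2 * Y}. dist_int (real (M * k + 1) * \<alpha> - \<gamma>) \<le> \<rho> \<and> d dvd M * k + 1}
      \<le> card (bohr_set (real (d * M) * \<alpha>) \<gamma>' \<rho> \<inter> {0..<0 + (Y div d + 1)})"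
      using card_bohr_progression_divisible_le[OF d0] by blast
    moreover have "{k \<in> B. d dvd M * k + 1} =
        {k \<in> {Y..<2 * Y}. dist_int (real (M * k + 1) * \<alpha> - \<gamma>) \<le> \<rho> \<and> d dvd M * k + 1}"
      by (auto simp: B_def)
    ultimately have Nd: "N d \<le> real (card (bohr_set (real (d * M) * \<alpha>) \<gamma>' \<rho> \<inter> {0..<0 + (Y div d + 1)}))"
      by (simp add: N_def)
    have "real_of_int \<lfloor>real Y / real d\<rfloor> = real (Y div d)" by (simp add: floor_divide_of_nat_eq)
    then have div_le: "real (Y div d + 1) \<le> real Y / d + 1" and div_ge: "real Y / d \<le> real (Y div d + 1)"
      by linarith+
    show ?thesis
    proof (cases "d \<le> D")
      case True
      have "c / real (d * M) ^ w * (real Y / d) * \<rho> ^ w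
          \<le> c / real (d * M) ^ w * real (Y div d + 1) * \<rho> ^ w"
        using c rho div_ge by (intro mult_right_mono mult_left_mono) auto
      then have "3 ^ w \<le> c / real (d * M) ^ w * real (Y div d + 1) * \<rho> ^ w"
        using key_d[of d] d0 True by linarith
      then have "N d \<le> 6 * real (Y div d + 1) * \<rho>"
        using Nd card_bohr_set_diophantine(2)[OF c_d dioph_d rho, of d "Y div d + 1" \<gamma>' 0] d0 by simp
      also have "\<dots> \<le> 6 * (2 * (real Y / d)) * \<rho>"
      proof -
        have "1 \<le> real Y / d" using True DY d0 by (simp add: field_simps)
        then have "real (Y div d + 1) \<le> 2 * (real Y / d)" using div_le by linarith
        then show ?thesis using rho by (intro mult_right_mono mult_left_mono) auto
      qed
      finally have "N d / d \<le> 6 * (2 * (real Y / d)) * \<rho> / d" by (rule divide_right_mono) simp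
      also have "\<dots> = 12 * real Y * \<rho> * (1 / (real d)\<^sup>2)" by (simp add: power2_eq_square)
      finally show ?thesis using True by simp
    next
      case False
      have "card (bohr_set (real (d * M) * \<alpha>) \<gamma>' \<rho> \<inter> {0..<0 + (Y div d + 1)}) \<le> card {0..<0 + (Y div d + 1)}"
        by (intro card_mono) auto
      then have "N d \<le> real (Y div d + 1)" using Nd by simp
      also have "\<dots> \<le> real Y / d + 1" by (rule div_le)
      also have "\<dots> \<le> real M * real Y / d + 2 * real M * real Y / d"
      proof (rule add_mono)
        have "1 * real Y \<le> real M * real Y" using M1 by (intro mult_right_mono) auto
        then show "real Y / d \<le> real M * real Y / d" by (intro divide_right_mono) auto
        have "real d \<le> 2 * real M * real Y" using d(2) by (metis of_nat_le_iff of_nat_mult of_nat_numeral)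
        then show "1 \<le> 2 * real M * real Y / d" using d0 by (simp add: field_simps)
      qed
      also have "\<dots> = 3 * real M * real Y / d" by (simp add: field_simps)
      finally have "N d / d \<le> 3 * real M * real Y / d / d" by (rule divide_right_mono) simp
      also have "\<dots> = 3 * real M * real Y * (1 / (real d)\<^sup>2)" by (simp add: power2_eq_square)
      finally have "N d / d \<le> 3 * real M * real Y * (1 / (real d)\<^sup>2)" .
      moreover have "0 \<le> 12 * real Y * \<rho> * (1 / (real d)\<^sup>2)" using rho by simp
      ultimately show ?thesis using False by simp
    qed
  qed
  define \<sigma> where "\<sigma> = (\<lambda>k. \<Sum>d | d dvd M * k + 1 \<and> 1 < d. 1 / real d)"
  have \<sigma>_eq: "\<sigma> k = (\<Sum>d\<in>{192<..2 * M * Y}. if d dvd M * k + 1 then 1 / real d else 0)" if "k \<in> B" for k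
  proof -
    have k: "k + 1 \<le> 2 * Y" using that by (auto simp: B_def)
    have "M * k + 1 \<le> M * (k + 1)" using M by simp
    also have "\<dots> \<le> M * (2 * Y)" using k by (rule mult_left_mono) simp
    finally have ub: "M * k + 1 \<le> 2 * M * Y" by simp
    have "{d. d dvd M * k + 1 \<and> 1 < d} = {d \<in> {192<..2 * M * Y}. d dvd M * k + 1}"
    proof (intro equalityI subsetI)
      fix d assume d: "d \<in> {d. d dvd M * k + 1 \<and> 1 < d}"
      have "\<not> d \<le> 192"
      proof
        assume "d \<le> 192"
        then have "d dvd M * k" using M(2)[of d] d by simp
        then have "d dvd 1" using d dvd_add_right_iff[of d "M * k" 1] by simp
        then show False using d by simp
      qed
      moreover have "d \<le> M * k + 1" using d by (auto intro: dvd_imp_le)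
      ultimately show "d \<in> {d \<in> {192<..2 * M * Y}. d dvd M * k + 1}" using d ub by auto
    qed auto
    then show ?thesis unfolding \<sigma>_def by (simp only: sum.inter_filter finite_greaterThanAtMost)
  qed
  have "(\<Sum>k\<in>B. \<sigma> k) = (\<Sum>k\<in>B. \<Sum>d\<in>{192<..2 * M * Y}. if d dvd M * k + 1 then 1 / real d else 0)"
    using \<sigma>_eq by simp
  also have "\<dots> = (\<Sum>d\<in>{192<..2 * M * Y}. \<Sum>k\<in>B. if d dvd M * k + 1 then 1 / real d else 0)"
    by (rule sum.swap)
  also have "\<dots> = (\<Sum>d\<in>{192<..2 * M * Y}. N d / d)"
    by (intro sum.cong refl) (simp add: N_def finB flip: sum.inter_filter)
  also have "\<dots> \<le> (\<Sum>d\<in>{192<..2 * M * Y}. 12 * real Y * \<rho> * (1 / (real d)\<^sup>2) +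
      (if D < d then 3 * real M * real Y * (1 / (real d)\<^sup>2) else 0))"
    by (intro sum_mono N_le) auto
  also have "\<dots> = 12 * real Y * \<rho> * (\<Sum>d\<in>{192<..2 * M * Y}. 1 / (real d)\<^sup>2) +
      (\<Sum>d\<in>{192<..2 * M * Y}. if D < d then 3 * real M * real Y * (1 / (real d)\<^sup>2) else 0)"
    by (simp only: sum.distrib sum_distrib_left)
  also have "\<dots> \<le> 12 * real Y * \<rho> * (1 / real 192) + 3 * real M * real Y * (1 / real D)"
  proof (rule add_mono)
    show "12 * real Y * \<rho> * (\<Sum>d\<in>{192<..2 * M * Y}. 1 / (real d)\<^sup>2) \<le> 12 * real Y * \<rho> * (1 / real 192)"
      using rho by (intro mult_left_mono sum_inverse_squares_le) auto
    have "(\<Sum>d\<in>{192<..2 * M * Y}. if D < d then 3 * real M * real Y * (1 / (real d)\<^sup>2) else 0)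
        = (\<Sum>d\<in>{d \<in> {192<..2 * M * Y}. D < d}. 3 * real M * real Y * (1 / (real d)\<^sup>2))"
      by (rule sum.inter_filter[symmetric]) simp
    also have "\<dots> \<le> (\<Sum>d\<in>{D<..2 * M * Y}. 3 * real M * real Y * (1 / (real d)\<^sup>2))"
      by (intro sum_mono2) auto
    also have "\<dots> = 3 * real M * real Y * (\<Sum>d\<in>{D<..2 * M * Y}. 1 / (real d)\<^sup>2)"
      by (simp only: sum_distrib_left)
    also have "\<dots> \<le> 3 * real M * real Y * (1 / real D)"
      using D1 by (intro mult_left_mono sum_inverse_squares_le) auto
    finally show "(\<Sum>d\<in>{192<..2 * M * Y}. if D < d then 3 * real M * real Y * (1 / (real d)\<^sup>2) else 0)
        \<le> 3 * real M * real Y * (1 / real D)" .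
  qed
  \<comment> \<open>The constants 192 and 48 make both terms at most Y\<rho>/16: 12/192 = 3/48 =
    1/16, and D \<ge> 48M/\<rho>.\<close>
  also have "\<dots> \<le> real Y * \<rho> / 8"
  proof -
    have "48 * real M \<le> D * \<rho>" using D_lo rho by (simp add: field_simps)
    then have "real Y * (48 * real M) \<le> real Y * (D * \<rho>)" by (rule mult_left_mono) simp
    then have "3 * real M * real Y * (1 / real D) \<le> real Y * \<rho> / 16" using D1 by (simp add: field_simps)
    moreover have "12 * real Y * \<rho> * (1 / real 192) = real Y * \<rho> / 16" by simp
    ultimately show ?thesis by linarith
  qed
  finally have sum_\<sigma>: "(\<Sum>k\<in>B. \<sigma> k) \<le> real Y * \<rho> / 8" .
  \<comment> \<open>Markov's inequality: every k in B outside \<open>Good\<close> has \<sigma>(k)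
    \<ge> 1/2, so at most Y\<rho>/4 of the at least Y\<rho>/2 elements of B are lost.\<close>
  define Good where "Good = {k \<in> B. M * k + 1 \<le> 2 * totient (M * k + 1)}"
  have \<sigma>0: "0 \<le> \<sigma> k" for k unfolding \<sigma>_def by (intro sum_nonneg) auto
  have "real (card (B - Good)) * (1 / 2) = (\<Sum>k\<in>B - Good. 1 / 2)" by simp
  also have "\<dots> \<le> (\<Sum>k\<in>B - Good. \<sigma> k)"
  proof (rule sum_mono)
    fix k assume "k \<in> B - Good"
    then have "2 * totient (M * k + 1) < M * k + 1" by (auto simp: Good_def)
    define n where "n = M * k + 1"
    have "2 * totient n < n" using \<open>2 * totient (M * k + 1) < M * k + 1\<close> by (simp add: n_def)
    then have "2 * real (totient n) < real n" by linarith
    moreover have "real n * (1 - \<sigma> k) \<le> real (totient n)"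
      unfolding \<sigma>_def n_def by (rule totient_ge_divisor_sum) simp
    ultimately have "real n * (1 - \<sigma> k) < real n * (1 / 2)" by linarith
    then have "1 - \<sigma> k < 1 / 2" by (rule mult_left_less_imp_less) simp
    then show "1 / 2 \<le> \<sigma> k" by simp
  qed
  also have "\<dots> \<le> (\<Sum>k\<in>B. \<sigma> k)" using finB \<sigma>0 by (intro sum_mono2) auto
  also note sum_\<sigma>
  finally have bad: "real (card (B - Good)) \<le> real Y * \<rho> / 4" by simp
  have "card B = card Good + card (B - Good)"
    using finB by (subst card_Un_disjoint[symmetric]) (auto simp: Good_def intro: arg_cong[of _ _ card])
  then have "real Y * \<rho> / 4 \<le> real (card Good)" using cardB bad by simp
  also have "Good = {k \<in> {Y..<2 * Y}. dist_int (real (M * k + 1) * \<alpha> - \<gamma>) \<le> \<rho> \<and>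
      M * k + 1 \<le> 2 * totient (M * k + 1)}" by (auto simp: Good_def B_def)
  finally show ?thesis .
qed

section \<open>The Diophantine exponent and Cauchy condensation\<close>

lemma not_liouville_diophantine:
  assumes irr: "\<alpha> \<notin> \<rat>" and "\<not> liouville \<alpha>"
  obtains c :: real and w :: nat where "c > 0" "\<And>q. q \<ge> 1 \<Longrightarrow> c / real q ^ w \<le> dist_int (real q * \<alpha>)"
proof -
  obtain v :: real where v: "v > 0"
    and ne: "liminf (\<lambda>n. ereal (real n powr v * dist_int (real n * \<alpha>))) \<noteq> 0"
    using assms by (auto simp: liouville_def)
  have "0 \<le> liminf (\<lambda>n. ereal (real n powr v * dist_int (real n * \<alpha>)))"
    by (intro Liminf_bounded always_eventually) auto
  with ne have "0 < liminf (\<lambda>n. ereal (real n powr v * dist_int (real n * \<alpha>)))" by simp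
  then obtain e where e: "0 < ereal e" "ereal e < liminf (\<lambda>n. ereal (real n powr v * dist_int (real n * \<alpha>)))"
    using ereal_dense2 by blast
  from less_LiminfD[OF e(2)] obtain N where N: "\<And>n. n \<ge> N \<Longrightarrow> e < real n powr v * dist_int (real n * \<alpha>)"
    by (auto simp: eventually_sequentially)
  \<comment> \<open>The real exponent is rounded up to a natural number. The finitely many q < N are
    absorbed into c, which stays positive because \<alpha> is irrational.\<close>
  define w where "w = nat \<lceil>v\<rceil>"
  define h where "h = (\<lambda>n. real n ^ w * dist_int (real n * \<alpha>))"
  define c where "c = Min (insert e (h ` {1..<N}))"
  have "c > 0" unfolding c_def
    using e dist_int_pos_of_irrational[OF irr] by (subst Min_gr_iff) (auto simp: h_def)
  moreover have "c / real q ^ w \<le> dist_int (real q * \<alpha>)" if q: "q \<ge> 1" for q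
  proof -
    have "c \<le> h q"
    proof (cases "q < N")
      case True
      then show ?thesis unfolding c_def using q by (intro Min_le) auto
    next
      case False
      have "c \<le> e" unfolding c_def by (intro Min_le) auto
      also have "e \<le> real q powr v * dist_int (real q * \<alpha>)" using N[of q] False by simp
      also have "\<dots> \<le> h q" unfolding h_def
      proof (rule mult_right_mono)
        have "v \<le> real w" unfolding w_def by (rule real_nat_ceiling_ge)
        then have "real q powr v \<le> real q powr real w" using q by (intro powr_mono) auto
        then show "real q powr v \<le> real q ^ w" using q by (simp add: powr_realpow)
      qed simp
      finally show ?thesis .
    qed
    then show ?thesis using q by (simp add: h_def field_simps)
  qed
  ultimately show thesis by (rule that)
qed

text \<open>Condensation at the points M 2^(i+1), which bound Mk + 1 from above for k < 2^(i+1). A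
  block has length 2M 2^i, and the logarithm on it is at most i(log M + 3); this needs i \<ge> 1,
  hence \<open>i0 \<ge> 1\<close>.\<close>

lemma sum_mult_ln_bounded_of_condensed:
  fixes \<psi> :: "nat \<Rightarrow> real"
  assumes nonneg: "\<And>n. n \<ge> 1 \<Longrightarrow> 0 \<le> \<psi> n"
    and antimono: "\<And>m n. 1 \<le> m \<Longrightarrow> m \<le> n \<Longrightarrow> \<psi> n \<le> \<psi> m"
    and M: "M \<ge> 1" and i0: "i0 \<ge> 1"
    and bound: "\<And>I. (\<Sum>i=i0..<I. real i * 2 ^ i * \<psi> (M * 2 ^ (i + 1))) \<le> S"
  shows "\<exists>T. \<forall>N. (\<Sum>n=1..N. \<psi> n * ln (real n)) \<le> T"
proof -
  define u where "u = (\<lambda>i. M * 2 ^ (i + 1))"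
  define C where "C = 2 * real M * (ln (real M) + 3)"
  have M1: "real M \<ge> 1" using M by simp
  have C: "C \<ge> 0" using M1 by (simp add: C_def)
  have u1: "1 \<le> u i" for i using M by (simp add: u_def)
  have u_mono: "u i \<le> u j" if "i \<le> j" for i j using that by (simp add: u_def)
  have term_nonneg: "0 \<le> \<psi> n * ln (real n)" if "n \<ge> 1" for n using nonneg[OF that] that by simp
  have block: "(\<Sum>n=u i..<u (Suc i). \<psi> n * ln (real n)) \<le> C * (real i * 2 ^ i * \<psi> (u i))" if i: "i \<ge> 1" for i
  proof -
    have lnu: "ln (real (u (Suc i))) \<le> real i * (ln (real M) + 3)"
    proof -
      have "ln (real (u (Suc i))) = ln (real M) + ln (2 ^ (i + 2))"
        using M by (simp add: u_def ln_mult)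
      also have "ln (2 ^ (i + 2) :: real) = real (i + 2) * ln 2" by (rule ln_realpow)
      also have "\<dots> \<le> real (i + 2) * 1"
        using ln_le_minus_one[of "2::real"] by (intro mult_left_mono) auto
      finally have "ln (real (u (Suc i))) \<le> ln (real M) + real (i + 2)" by simp
      moreover have "1 * ln (real M) \<le> real i * ln (real M)" using i M1 by (intro mult_right_mono) auto
      ultimately show ?thesis using i by (simp add: algebra_simps)
    qed
    have "(\<Sum>n=u i..<u (Suc i). \<psi> n * ln (real n))
        \<le> (\<Sum>n=u i..<u (Suc i). \<psi> (u i) * (real i * (ln (real M) + 3)))"
    proof (rule sum_mono)
      fix n assume n: "n \<in> {u i..<u (Suc i)}"
      then have n1: "1 \<le> n" using u1[of i] by simp
      have "ln (real n) \<le> ln (real (u (Suc i)))" using n n1 by (subst ln_le_cancel_iff) auto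
      with lnu have "ln (real n) \<le> real i * (ln (real M) + 3)" by linarith
      then show "\<psi> n * ln (real n) \<le> \<psi> (u i) * (real i * (ln (real M) + 3))"
        using n n1 u1 by (intro mult_mono antimono nonneg) auto
    qed
    also have "\<dots> = C * (real i * 2 ^ i * \<psi> (u i))"
      by (simp add: u_def C_def mult_ac)
    finally show ?thesis .
  qed
  have "(\<Sum>n=1..<u I. \<psi> n * ln (real n)) \<le>
      (\<Sum>n=1..<u i0. \<psi> n * ln (real n)) + C * (\<Sum>i=i0..<I. real i * 2 ^ i * \<psi> (u i))" if "i0 \<le> I" for I
    using that
  proof (induction I rule: dec_induct)
    case (step I)
    have "(\<Sum>n=1..<u (Suc I). \<psi> n * ln (real n))
        = (\<Sum>n=1..<u I. \<psi> n * ln (real n)) + (\<Sum>n=u I..<u (Suc I). \<psi> n * ln (real n))"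
      using u1 u_mono[of I "Suc I"] by (intro sum.atLeastLessThan_concat[symmetric]) auto
    also have "\<dots> \<le> (\<Sum>n=1..<u i0. \<psi> n * ln (real n)) + C * (\<Sum>i=i0..<I. real i * 2 ^ i * \<psi> (u i)) +
        C * (real I * 2 ^ I * \<psi> (u I))"
      using step i0 by (intro add_mono block) auto
    also have "\<dots> = (\<Sum>n=1..<u i0. \<psi> n * ln (real n)) + C * (\<Sum>i=i0..<Suc I. real i * 2 ^ i * \<psi> (u i))"
      using step by (simp add: algebra_simps)
    finally show ?case .
  qed simp
  note ind = this
  have "(\<Sum>n=1..N. \<psi> n * ln (real n)) \<le> (\<Sum>n=1..<u i0. \<psi> n * ln (real n)) + C * S" for N
  proof -
    define I where "I = max i0 N"
    have "N < 2 ^ N" by (rule less_exp)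
    also have "(2::nat) ^ N \<le> 2 ^ (I + 1)" by (intro power_increasing) (auto simp: I_def)
    also have "\<dots> \<le> u I" using M by (simp add: u_def)
    finally have "N < u I" .
    then have "(\<Sum>n=1..N. \<psi> n * ln (real n)) \<le> (\<Sum>n=1..<u I. \<psi> n * ln (real n))"
      using term_nonneg by (intro sum_mono2) auto
    also have "\<dots> \<le> (\<Sum>n=1..<u i0. \<psi> n * ln (real n)) + C * (\<Sum>i=i0..<I. real i * 2 ^ i * \<psi> (u i))"
      by (rule ind) (simp add: I_def)
    also have "\<dots> \<le> (\<Sum>n=1..<u i0. \<psi> n * ln (real n)) + C * S"
      using bound[of I] C by (intro add_left_mono mult_left_mono) (auto simp: u_def)
    finally show ?thesis .
  qed
  then show ?thesis by blast
qed

section \<open>Divergence of the Duffin--Schaeffer series\<close>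

text \<open>A Bohr set of radius s/6 centred at \<gamma> + s lies in an annulus around \<gamma>.
  Lower bounds for Bohr sets thus apply to annuli without subtracting an inner set.\<close>

lemma dist_int_annulus:
  assumes "dist_int (x - s) \<le> s / 6" "0 \<le> s" "s \<le> 1 / 2"
  shows "5 / 6 * s \<le> dist_int x" "dist_int x \<le> 7 / 6 * s"
proof -
  have s: "dist_int s = s" using assms by (simp add: dist_int_eq_abs)
  show "dist_int x \<le> 7 / 6 * s"
    using dist_int_add_le[of "x - s" s] assms s by simp
  show "5 / 6 * s \<le> dist_int x"
    using dist_int_add_le[of x "- (x - s)"] assms s dist_int_minus[of "x - s"] by simp
qed

text \<open>The elements \<open>n\<close> of a dyadic block are sorted into \<open>\<asymp> log n\<close> annuli
  \<open>\<parallel>n\<alpha> - \<gamma>\<parallel> \<asymp> 2\<^sup>-\<^sup>j\<close>, which contribute equally.\<close>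

lemma sum_inverse_dist_int_block_ge:
  fixes \<alpha> \<gamma> :: real and \<psi> :: "nat \<Rightarrow> real"
  defines "\<delta> \<equiv> \<lambda>n. if 1 \<le> n \<and> n \<le> 2 * totient n then \<psi> n / dist_int (real n * \<alpha> - \<gamma>) else 0"
  assumes c: "c > 0" and dioph: "\<And>q. q \<ge> 1 \<Longrightarrow> c / real q ^ w \<le> dist_int (real q * \<alpha>)"
    and M: "M > 0" "\<And>d. 0 < d \<Longrightarrow> d \<le> 192 \<Longrightarrow> d dvd M"
    and nonneg: "\<And>n. n \<ge> 1 \<Longrightarrow> 0 \<le> \<psi> n"
    and antimono: "\<And>m n. 1 \<le> m \<Longrightarrow> m \<le> n \<Longrightarrow> \<psi> n \<le> \<psi> m"
  shows "eventually (\<lambda>i. real i * 2 ^ i * \<psi> (M * 2 ^ (i + 1))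
      \<le> 128 * real (2 * w + 1) * (\<Sum>k\<in>{2 ^ i..<2 ^ Suc i}. \<delta> (M * k + 1))) sequentially"
proof -
  define v where "v = 2 * w + 1"
  \<comment> \<open>Chosen so that 2^i \<ge> K 2^(jv) is the size condition of
    \<open>card_bohr_progression_totient_ge\<close> for Y = 2^i and \<rho> = s(j)/6 = 2^-j/8; the
    latter gives the factor 8^v.\<close>
  define K where "K = 3 ^ w * (49 * real M) ^ (w + 1) * real M ^ w / c * 8 ^ v"
  have v: "v \<ge> 1" by (simp add: v_def)
  have K0: "K \<ge> 0" using c by (simp add: K_def)
  \<comment> \<open>Half of the exponent i pays for K and the other half for 2^(jv); this is why j
    runs only up to i/(2v).\<close>
  obtain i0 where i0: "K\<^sup>2 < 2 ^ i0" using real_arch_pow[of 2 "K\<^sup>2"] by auto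
  have "K\<^sup>2 \<le> 2 ^ i" if "i \<ge> i0" for i
    using i0 power_increasing[OF that, of "2::real"] by linarith
  then have "eventually (\<lambda>i. K\<^sup>2 \<le> 2 ^ i) sequentially" unfolding eventually_sequentially by blast
  with eventually_ge_at_top[of "2 * v"] show ?thesis
  proof eventually_elim
    case (elim i)
    define J where "J = {1..i div (2 * v)}"
    \<comment> \<open>With the factor 3/4 the outer radius 7s/6 is below 2^-j, and successive annuli
      are disjoint because 7/12 < 5/6.\<close>
    define s where "s = (\<lambda>j::nat. 3 / 4 * (1 / 2 :: real) ^ j)"
    define E where "E = (\<lambda>j. {k \<in> {2 ^ i..<2 * 2 ^ i}.
      dist_int (real (M * k + 1) * \<alpha> - (\<gamma> + s j)) \<le> s j / 6 \<and> M * k + 1 \<le> 2 * totient (M * k + 1)})"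
    define p where "p = \<psi> (M * 2 ^ (i + 1))"
    have p0: "p \<ge> 0" using nonneg M by (simp add: p_def)
    have s: "0 < s j" for j by (simp add: s_def)
    have s_half: "s j \<le> 1 / 2" if "j \<in> J" for j
    proof -
      have "(1 / 2 :: real) ^ j \<le> (1 / 2) ^ 1" using that by (intro power_decreasing) (auto simp: J_def)
      then show ?thesis by (simp add: s_def)
    qed
    have E_dist: "5 / 6 * s j \<le> dist_int (real (M * k + 1) * \<alpha> - \<gamma>)"
      "dist_int (real (M * k + 1) * \<alpha> - \<gamma>) \<le> 7 / 6 * s j" if "j \<in> J" "k \<in> E j" for j k
    proof -
      have "dist_int (real (M * k + 1) * \<alpha> - \<gamma> - s j) \<le> s j / 6"
        using that by (simp add: E_def diff_diff_eq)
      from dist_int_annulus[OF this] s[of j] s_half[OF that(1)]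
      show "5 / 6 * s j \<le> dist_int (real (M * k + 1) * \<alpha> - \<gamma>)"
        "dist_int (real (M * k + 1) * \<alpha> - \<gamma>) \<le> 7 / 6 * s j" by auto
    qed
    have disj: "E j \<inter> E j' = {}" if "j \<in> J" "j' \<in> J" "j < j'" for j j'
    proof (rule ccontr)
      assume "E j \<inter> E j' \<noteq> {}"
      then obtain k where "k \<in> E j" "k \<in> E j'" by blast
      then have "5 / 6 * s j \<le> 7 / 6 * s j'" using E_dist that by (meson order_trans)
      moreover have "s j' \<le> s j / 2"
      proof -
        have "(1 / 2 :: real) ^ j' \<le> (1 / 2) ^ Suc j" using that by (intro power_decreasing) auto
        then show ?thesis by (simp add: s_def)
      qed
      ultimately show False using s[of j] by linarith
    qed
    have E_card: "2 ^ i * (s j / 6) / 4 \<le> real (card (E j))" if "j \<in> J" for j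
    proof -
      have jv: "j * (2 * v) \<le> i"
      proof -
        have "j * (2 * v) \<le> i div (2 * v) * (2 * v)" using that by (intro mult_right_mono) (auto simp: J_def)
        also have "\<dots> \<le> i" by simp
        finally show ?thesis .
      qed
      define P where "P = (2::real) ^ (j * v)"
      have "P\<^sup>2 = 2 ^ (j * (2 * v))" by (simp add: P_def mult_ac flip: power_mult)
      also have "\<dots> \<le> 2 ^ i" using jv by (intro power_increasing) auto
      finally have P2: "P\<^sup>2 \<le> 2 ^ i" .
      have "(K * P)\<^sup>2 \<le> (2 ^ i)\<^sup>2"
        using mult_mono[OF elim(2) P2] by (simp add: power2_eq_square mult_ac)
      then have KP: "K * P \<le> 2 ^ i" by (rule power2_le_imp_le) simp
      have s6: "s j / 6 = 1 / (8 * 2 ^ j)" by (simp add: s_def power_one_over)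
      have "(s j / 6) ^ v = 1 / (8 ^ v * P)"
        by (simp add: s6 P_def power_divide power_mult_distrib flip: power_mult)
      then have "c * 2 ^ i * (s j / 6) ^ v = c * (2 ^ i) / (8 ^ v * P)" by simp
      also have "\<dots> \<ge> c * (K * P) / (8 ^ v * P)"
        using KP c by (intro divide_right_mono mult_left_mono) (auto simp: P_def)
      also have "c * (K * P) / (8 ^ v * P) = 3 ^ w * (49 * real M) ^ (w + 1) * real M ^ w"
        using c by (simp add: K_def P_def)
      finally have cond: "3 ^ w * (49 * real M) ^ (w + 1) * real M ^ w \<le> c * real (2 ^ i) * (s j / 6) ^ (2 * w + 1)"
        by (simp add: v_def)
      have "0 < s j / 6" "s j / 6 \<le> 1 / 2" using s[of j] s_half[OF that] by auto
      from card_bohr_progression_totient_ge[OF c dioph M this cond, of "\<gamma> + s j"]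
      show ?thesis by (simp add: E_def)
    qed
    have \<delta>_nonneg: "0 \<le> \<delta> n" for n using nonneg by (simp add: \<delta>_def)
    have \<delta>_ge: "p * 2 ^ j \<le> \<delta> (M * k + 1)" if "j \<in> J" "k \<in> E j" for j k
    proof -
      define x where "x = dist_int (real (M * k + 1) * \<alpha> - \<gamma>)"
      have "5 / 6 * s j \<le> x" "x \<le> 7 / 6 * s j" using E_dist[OF that] by (simp_all add: x_def)
      moreover have "7 / 6 * s j \<le> (1 / 2) ^ j" by (simp add: s_def)
      ultimately have x: "0 < x" "x \<le> (1 / 2) ^ j" using s[of j] by linarith+
      have "k + 1 \<le> 2 ^ (i + 1)" using that by (auto simp: E_def)
      then have "M * (k + 1) \<le> M * 2 ^ (i + 1)" by (rule mult_left_mono) simp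
      then have "M * k + 1 \<le> M * 2 ^ (i + 1)" using M by simp
      then have "p \<le> \<psi> (M * k + 1)" unfolding p_def by (intro antimono) auto
      then have "p / (1 / 2) ^ j \<le> \<psi> (M * k + 1) / x" using x p0 by (intro frac_le) auto
      then have "p * 2 ^ j \<le> \<psi> (M * k + 1) / x" by (simp add: power_one_over)
      then show ?thesis using that by (simp add: \<delta>_def E_def x_def)
    qed
    have "real i * 2 ^ i * p \<le> (4 * real v * real (i div (2 * v))) * 2 ^ i * p"
    proof -
      have "1 \<le> i div (2 * v)" using elim(1) v by (simp add: div_greater_zero_iff Suc_le_eq)
      then have "1 * (2 * v) \<le> i div (2 * v) * (2 * v)" by (rule mult_right_mono) simp
      moreover have "i < i div (2 * v) * (2 * v) + 2 * v"
        using v dividend_less_div_times[of "2 * v" i] by simp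
      ultimately have "i \<le> 2 * (i div (2 * v) * (2 * v))" by linarith
      then have "real i \<le> real (2 * (i div (2 * v) * (2 * v)))" by (rule of_nat_mono)
      also have "\<dots> = 4 * real v * real (i div (2 * v))" by simp
      finally show ?thesis using p0 by (intro mult_right_mono) auto
    qed
    \<comment> \<open>128v = 4v * 32. There are at least i/(4v) annuli, and each has at least 2^i
      s(j)/24 = 2^(i-j)/32 elements with \<delta> \<ge> 2^j p.\<close>
    also have "\<dots> = 128 * real v * (\<Sum>j\<in>J. 2 ^ i * p / 32)" by (simp add: J_def)
    also have "\<dots> \<le> 128 * real v * (\<Sum>j\<in>J. \<Sum>k\<in>E j. \<delta> (M * k + 1))"
    proof (intro mult_left_mono sum_mono)
      fix j assume j: "j \<in> J"
      have "2 ^ i * p / 32 = (2 ^ i * (s j / 6) / 4) * (p * 2 ^ j)"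
        by (simp add: s_def power_one_over)
      also have "\<dots> \<le> real (card (E j)) * (p * 2 ^ j)"
        using E_card[OF j] p0 by (intro mult_right_mono) auto
      also have "\<dots> = (\<Sum>k\<in>E j. p * 2 ^ j)" by simp
      also have "\<dots> \<le> (\<Sum>k\<in>E j. \<delta> (M * k + 1))" by (intro sum_mono \<delta>_ge j)
      finally show "2 ^ i * p / 32 \<le> (\<Sum>k\<in>E j. \<delta> (M * k + 1))" .
    qed simp
    also have "(\<Sum>j\<in>J. \<Sum>k\<in>E j. \<delta> (M * k + 1)) = (\<Sum>k\<in>(\<Union>j\<in>J. E j). \<delta> (M * k + 1))"
    proof (rule sum.UNION_disjoint[symmetric])
      show "\<forall>j\<in>J. \<forall>j'\<in>J. j \<noteq> j' \<longrightarrow> E j \<inter> E j' = {}"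
        using disj by (metis Int_commute nat_neq_iff)
    qed (auto simp: J_def E_def)
    also have "\<dots> \<le> (\<Sum>k\<in>{2 ^ i..<2 ^ Suc i}. \<delta> (M * k + 1))"
      using \<delta>_nonneg by (intro sum_mono2) (auto simp: E_def)
    finally show ?case by (simp add: p_def v_def mult_left_mono)
  qed
qed

theorem theorem1p3:
  fixes \<alpha> \<gamma> :: real and \<psi> :: "nat \<Rightarrow> real"
  assumes "\<alpha> \<notin> \<rat>" and "\<not> liouville \<alpha>"
    and "\<And>n. n \<ge> 1 \<Longrightarrow> \<psi> n \<ge> 0"
    and "\<And>n. n \<ge> 1 \<Longrightarrow> \<psi> n \<ge> \<psi> (n + 1)"
    and "filterlim (\<lambda>N. \<Sum>n = 1..N. \<psi> n * ln (real n)) at_top sequentially"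
  shows "AE \<beta> in lebesgue. infinite {n::nat. n \<ge> 1 \<and>
           dist_int (real n * \<alpha> - \<gamma>) * dist_int (real n * \<beta>) < \<psi> n}"
proof -
  \<comment> \<open>If n\<alpha> - \<gamma> is an integer, division by zero gives \<delta>(n) = 0,
    which merely discards n. The test 1 \<le> n excludes 0, which would pass the totient
    test.\<close>
  define \<delta> where "\<delta> = (\<lambda>n. if 1 \<le> n \<and> n \<le> 2 * totient n then \<psi> n / dist_int (real n * \<alpha> - \<gamma>) else 0)"
  have nonneg: "0 \<le> \<psi> n" if "n \<ge> 1" for n using assms(3) that by simp
  have antimono: "\<psi> n \<le> \<psi> m" if "1 \<le> m" "m \<le> n" for m n
    using that(2,1)
  proof (induction n rule: dec_induct)
    case (step n)
    then show ?case using assms(4)[of n] by simp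
  qed simp
  have \<delta>_nonneg: "0 \<le> \<delta> n" for n using nonneg by (simp add: \<delta>_def)
  have "\<not> summable \<delta>"
  proof
    assume summ: "summable \<delta>"
    obtain c w where c: "c > 0" "\<And>q. q \<ge> 1 \<Longrightarrow> c / real q ^ w \<le> dist_int (real q * \<alpha>)"
      using not_liouville_diophantine[OF assms(1,2)] by blast
    obtain M :: nat where M: "M > 0" "\<And>d. 0 < d \<Longrightarrow> d \<le> 192 \<Longrightarrow> d dvd M"
    proof (rule that[of "fact 192"])
      show "d dvd fact 192" if "0 < d" "d \<le> 192" for d :: nat
        using that by (intro dvd_fact) auto
    qed (rule fact_gt_zero)
    define C where "C = 128 * real (2 * w + 1)"
    obtain i1 where i1: "\<And>i. i \<ge> i1 \<Longrightarrow> real i * 2 ^ i * \<psi> (M * 2 ^ (i + 1))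
        \<le> C * (\<Sum>k\<in>{2 ^ i..<2 ^ Suc i}. \<delta> (M * k + 1))"
      using sum_inverse_dist_int_block_ge[where \<gamma> = \<gamma> and \<psi> = \<psi>, OF c M nonneg antimono]
      unfolding eventually_sequentially C_def \<delta>_def by blast
    define i0 where "i0 = max 1 i1"
    have "(\<Sum>i=i0..<I. real i * 2 ^ i * \<psi> (M * 2 ^ (i + 1))) \<le> C * suminf \<delta>" for I
    proof -
      have "(\<Sum>i=i0..<I. real i * 2 ^ i * \<psi> (M * 2 ^ (i + 1)))
          \<le> (\<Sum>i=i0..<I. C * (\<Sum>k\<in>{2 ^ i..<2 ^ Suc i}. \<delta> (M * k + 1)))"
        by (intro sum_mono i1) (auto simp: i0_def)
      also have "\<dots> = C * (\<Sum>i=i0..<I. \<Sum>k\<in>{2 ^ i..<2 ^ Suc i}. \<delta> (M * k + 1))"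
        by (rule sum_distrib_left[symmetric])
      \<comment> \<open>The dyadic blocks tile an initial range of k, and Mk + 1 takes distinct
        values on it, so the double sum stays below the total of the series.\<close>
      also have "(\<Sum>i=i0..<I. \<Sum>k\<in>{2 ^ i..<2 ^ Suc i}. \<delta> (M * k + 1))
          \<le> (\<Sum>i<I. \<Sum>k\<in>{2 ^ i..<2 ^ Suc i}. \<delta> (M * k + 1))"
        using \<delta>_nonneg by (intro sum_mono2 sum_nonneg) auto
      also have "\<dots> = (\<Sum>k\<in>{1..<2 ^ I}. \<delta> (M * k + 1))"
      proof (induction I)
        case (Suc I)
        have "(\<Sum>k\<in>{1..<2 ^ I}. \<delta> (M * k + 1)) + (\<Sum>k\<in>{2 ^ I..<2 ^ Suc I}. \<delta> (M * k + 1))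
            = (\<Sum>k\<in>{1..<2 ^ Suc I}. \<delta> (M * k + 1))"
          by (rule sum.atLeastLessThan_concat) auto
        with Suc show ?case by simp
      qed simp
      also have "\<dots> = sum \<delta> ((\<lambda>k. M * k + 1) ` {1..<2 ^ I})"
        using M by (subst sum.reindex) (auto simp: inj_on_def)
      also have "\<dots> \<le> suminf \<delta>" using summ \<delta>_nonneg by (intro sum_le_suminf) auto
      finally show ?thesis by (simp add: C_def mult_left_mono)
    qed
    then obtain T where T: "\<And>N. (\<Sum>n=1..N. \<psi> n * ln (real n)) \<le> T"
      using sum_mult_ln_bounded_of_condensed[of \<psi>, OF nonneg antimono, of M i0 "C * suminf \<delta>"] M
      by (auto simp: i0_def)
    have "eventually (\<lambda>N. T + 1 \<le> (\<Sum>n=1..N. \<psi> n * ln (real n))) sequentially"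
      using assms(5) by (simp add: filterlim_at_top)
    then obtain N where "T + 1 \<le> (\<Sum>n=1..N. \<psi> n * ln (real n))"
      by (auto simp: eventually_sequentially)
    with T[of N] show False by simp
  qed
  moreover have "n \<le> 2 * totient n" if "\<delta> n > 0" for n
    using that by (simp add: \<delta>_def split: if_splits)
  ultimately have "AE \<beta> in lborel. infinite {n. dist_int (real n * \<beta>) < \<delta> n}"
    using \<delta>_nonneg by (intro duffin_schaeffer)
  then have "AE \<beta> in lebesgue. infinite {n. dist_int (real n * \<beta>) < \<delta> n}"
    by (rule AE_completion)
  then show ?thesis
  proof eventually_elim
    case (elim \<beta>)
    have "{n. dist_int (real n * \<beta>) < \<delta> n} \<subseteq>
        {n. n \<ge> 1 \<and> dist_int (real n * \<alpha> - \<gamma>) * dist_int (real n * \<beta>) < \<psi> n}"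
    proof
      fix n assume "n \<in> {n. dist_int (real n * \<beta>) < \<delta> n}"
      then have less: "dist_int (real n * \<beta>) < \<delta> n" by simp
      then have pos: "\<delta> n > 0" using dist_int_nonneg[of "real n * \<beta>"] by linarith
      then have n: "n \<ge> 1" and eq: "\<delta> n = \<psi> n / dist_int (real n * \<alpha> - \<gamma>)"
        by (auto simp: \<delta>_def split: if_splits)
      have "dist_int (real n * \<alpha> - \<gamma>) \<noteq> 0" using pos eq by auto
      then have "dist_int (real n * \<alpha> - \<gamma>) > 0" using dist_int_nonneg[of "real n * \<alpha> - \<gamma>"] by linarith
      with less eq n show "n \<in> {n. n \<ge> 1 \<and> dist_int (real n * \<alpha> - \<gamma>) * dist_int (real n * \<beta>) < \<psi> n}"
        by (simp add: pos_less_divide_eq mult.commute)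
    qed
    with elim show ?case using finite_subset by blast
  qed
qed

end
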